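(* Let $T>0$ and $s>3/2$, and let $u\in C([0,T]:H^s(\mathbb{R}))$ be a strong solution of the initial value problem associated to the Camassa-Holm equation in integral-differential form $$\partial_t u+u\,\partial_x u+\partial_x G\ast\Big(u^2+\tfrac12(\partial_x u)^2\Big)=0,\qquad G(x)=\tfrac12 e^{-|x|},$$ with initial datum $u_0(x)=u(x,0)$. Suppose that for some $\theta\in(0,1)$ $$|u_0(x)|= O(e^{-\theta x})\quad\text{and}\quad |\partial_x u_0(x)|= O(e^{-\theta x})\qquad\text{as } x\to+\infty.$$ Then $$|u(x,t)|= O(e^{-\theta x})\quad\text{and}\quad |\partial_x u(x,t)|= O(e^{-\theta x})\qquad\text{as } x\to+\infty,$$ uniformly in $t\in[0,T]$ (i.e. there are constants $C,X>0$ such that $|u(x,t)|+|\partial_xu(x,t)|\le Ce^{-\theta x}$ for all $x\ge X$ and all $t\in[0,T]$).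
   Context: Functions are real-valued, $\ast$ denotes convolution in $x\in\mathbb{R}$, and $H^s(\mathbb{R})$ is the usual $L^2$-based Sobolev space. A strong solution on $[0,T]$ is a function $u\in C([0,T]:H^s(\mathbb{R}))\cap C^1([0,T]:H^{s-1}(\mathbb{R}))$ satisfying the equation for every $t\in[0,T]$ as an identity in $H^{s-1}(\mathbb{R})$. Since $s>3/2$, $u(\cdot,t)$ and $\partial_x u(\cdot,t)$ are continuous bounded functions, so pointwise statements make sense. The equation is the integral-differential form of the Camassa-Holm equation $\partial_t u-\partial_t\partial_x^2u+3u\partial_xu-2\partial_xu\,\partial_x^2u-u\,\partial_x^3u=0$, obtained by inverting $1-\partial_x^2$, whose fundamental solution is $\tfrac12e^{-|x|}$. *)

theory Defs
  imports "HOL-Analysis.Analysis" "HOL-Library.Landau_Symbols"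
begin

definition square_integrable :: "(real \<Rightarrow> 'a::real_normed_vector) \<Rightarrow> bool" where
  "square_integrable f \<longleftrightarrow>
     f \<in> borel_measurable lborel \<and> integrable lborel (\<lambda>x. (norm (f x))\<^sup>2)"

definition truncated_fourier :: "real \<Rightarrow> (real \<Rightarrow> real) \<Rightarrow> real \<Rightarrow> complex" where
  "truncated_fourier R f \<xi> =
     (LINT x:{-R..R}|lborel. complex_of_real (f x) * cis (- (x * \<xi>))) / complex_of_real (sqrt (2 * pi))"

text \<open>
  \<open>g\<close> is (a representative of) the Fourier--Plancherel transform of \<open>f \<in> L\<^sup>2\<close>: the limit in
  \<open>L\<^sup>2\<close> of the Fourier integrals over \<open>[-R, R]\<close>, normalised so as to be unitary. The nonnegative
  integral is used since, unlike the Bochner integral, it does not vanish on non-integrable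
  functions.
\<close>
definition is_fourier_transform :: "(real \<Rightarrow> real) \<Rightarrow> (real \<Rightarrow> complex) \<Rightarrow> bool" where
  "is_fourier_transform f g \<longleftrightarrow>
     square_integrable g \<and>
     ((\<lambda>R. \<integral>\<^sup>+ \<xi>. ennreal ((cmod (truncated_fourier R f \<xi> - g \<xi>))\<^sup>2) \<partial>lborel) \<longlongrightarrow> 0) at_top"

text \<open>
  The space \<open>H\<^sup>s(\<real>)\<close> of real-valued functions, for \<open>s \<ge> 0\<close>. (For \<open>s < 0\<close> this is only
  \<open>L\<^sup>2\<close>; below only \<open>s > 3/2\<close> and \<open>s - 1 > 1/2\<close> occur.) Elements are functions, not
  equivalence classes modulo null sets.
\<close>
definition sobolev :: "real \<Rightarrow> (real \<Rightarrow> real) set" where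
  "sobolev s = {f. square_integrable f \<and>
     (\<exists>g. is_fourier_transform f g \<and>
          integrable lborel (\<lambda>\<xi>. (1 + \<xi>\<^sup>2) powr s * (cmod (g \<xi>))\<^sup>2))}"

text \<open>The Fourier transform is unique almost everywhere, so the norm does not depend on the choice.\<close>
definition sobolev_norm :: "real \<Rightarrow> (real \<Rightarrow> real) \<Rightarrow> real" where
  "sobolev_norm s f =
     (let g = (SOME g. is_fourier_transform f g)
      in sqrt (LINT \<xi>|lborel. (1 + \<xi>\<^sup>2) powr s * (cmod (g \<xi>))\<^sup>2))"

text \<open>\<open>u \<in> C([0,T] : H\<^sup>s)\<close>; the first argument of \<open>u\<close> is the time.\<close>
definition sobolev_continuous :: "real \<Rightarrow> real \<Rightarrow> (real \<Rightarrow> real \<Rightarrow> real) \<Rightarrow> bool" where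
  "sobolev_continuous s T u \<longleftrightarrow>
     (\<forall>t\<in>{0..T}. u t \<in> sobolev s) \<and>
     (\<forall>t\<in>{0..T}. ((\<lambda>r. sobolev_norm s (\<lambda>x. u r x - u t x)) \<longlongrightarrow> 0) (at t within {0..T}))"

text \<open>\<open>v\<close> is the time derivative of \<open>u\<close> on \<open>[0,T]\<close> in the norm of \<open>H\<^sup>s\<close>, one-sided at the end points.\<close>
definition sobolev_time_derivative ::
    "real \<Rightarrow> real \<Rightarrow> (real \<Rightarrow> real \<Rightarrow> real) \<Rightarrow> (real \<Rightarrow> real \<Rightarrow> real) \<Rightarrow> bool" where
  "sobolev_time_derivative s T u v \<longleftrightarrow>
     (\<forall>t\<in>{0..T}. ((\<lambda>r. sobolev_norm s (\<lambda>x. (u r x - u t x) / (r - t) - v t x)) \<longlongrightarrow> 0)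
                  (at t within {0..T}))"

definition convolution :: "(real \<Rightarrow> real) \<Rightarrow> (real \<Rightarrow> real) \<Rightarrow> real \<Rightarrow> real" where
  "convolution f g x = (LINT y|lborel. f (x - y) * g y)"

definition G :: "real \<Rightarrow> real" where
  "G x = exp (- \<bar>x\<bar>) / 2"

text \<open>
  Strong solutions \<open>u \<in> C([0,T] : H\<^sup>s) \<inter> C\<^sup>1([0,T] : H\<^sup>s\<^sup>-\<^sup>1)\<close>, for \<open>s > 3/2\<close>.
  The continuity requirement says that \<open>u t\<close> is the continuous representative of its class in
  \<open>H\<^sup>s\<close>; by the Sobolev embedding it is then of class \<open>C\<^sup>1\<close>, and \<open>deriv (u t)\<close> is its classical
  derivative. The equation is an identity in \<open>H\<^sup>s\<^sup>-\<^sup>1\<close>, that is, between functions modulo null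
  sets. The function \<open>deriv G\<close> is the classical derivative of \<open>G\<close> off the origin, hence it
  represents the distributional one; its unspecified value at \<open>0\<close> does not affect the convolution.
\<close>
definition strong_CH_solution :: "real \<Rightarrow> real \<Rightarrow> (real \<Rightarrow> real \<Rightarrow> real) \<Rightarrow> bool" where
  "strong_CH_solution s T u \<longleftrightarrow>
     sobolev_continuous s T u \<and>
     (\<forall>t\<in>{0..T}. continuous_on UNIV (u t)) \<and>
     (\<exists>v. sobolev_continuous (s - 1) T v \<and>
          sobolev_time_derivative (s - 1) T u v \<and>
          (\<forall>t\<in>{0..T}. AE x in lborel.
             v t x + u t x * deriv (u t) x +
             convolution (deriv G) (\<lambda>y. (u t y)\<^sup>2 + (deriv (u t) y)\<^sup>2 / 2) x = 0))"

end

theory Submission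
  imports Defs "HOL-Probability.Characteristic_Functions" "HOL-Real_Asymp.Real_Asymp"
begin

text \<open>
  Exponential decay propagates because the Camassa--Holm equation is a transport equation with
  bounded velocity, and its nonlocal source preserves any weight that varies more slowly than the
  kernel \<open>exp (- \<bar>x\<bar>)\<close>.

  Write \<open>p = \<partial>\<^sub>x G \<ast> F\<close> with \<open>F = u\<^sup>2 + (\<partial>\<^sub>x u)\<^sup>2 / 2\<close>, and let \<open>b\<close> be a positive weight with
  \<open>b y \<le> b x * exp (\<theta> * \<bar>x - y\<bar>)\<close>. If \<open>\<bar>F\<bar> \<le> S * b\<close>, then \<open>\<bar>p\<bar>\<close> and the difference quotients of
  \<open>p\<close> are at most a constant times \<open>S * b\<close>, because \<open>exp ((\<theta> - 1) * \<bar>x\<bar>)\<close> is integrable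
  (\<open>convolution_deriv_G_bound\<close>, \<open>convolution_deriv_G_diff\<close>). This is where \<open>\<theta> < 1\<close> enters.
  Since \<open>F\<close> is quadratic, uniform bounds on \<open>u\<close> and \<open>\<partial>\<^sub>x u\<close> turn a bound
  \<open>\<bar>u\<bar>, \<bar>\<partial>\<^sub>x u\<bar> \<le> Z * exp (L * t) * b\<close> into a bound of the same kind on \<open>F\<close>.

  The function \<open>u\<close> satisfies \<open>\<partial>\<^sub>t u + u * \<partial>\<^sub>x u = - p\<close>. The second derivative of \<open>u\<close> in space need not
  exist, so the equation is not differentiated. Instead the quotient
  \<open>w = (u(x + h) - u(x)) / h\<close> is used: it satisfies the transport equation with the same velocity
  \<open>u\<close>, whose source is \<open>- \<partial>\<^sub>x u(x + h) * w\<close> minus the difference quotient of \<open>p\<close>. Evaluating the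
  equation at a maximum of \<open>exp (- L * t) * w / b\<close> gives
  \<open>transport_maximum_principle\<close>. It shows that the bound with constant \<open>Z\<close> implies the bound with
  constant \<open>max A (Z / 2)\<close>, where \<open>A\<close> comes from the initial datum and \<open>L\<close> is large. Iteration
  gives the bound with constant \<open>A\<close>.

  The iteration needs some finite \<open>Z\<close> to start from, and the maximum must be attained. Both hold for
  \<open>b x = exp (- \<theta> * x) + \<epsilon> * exp (\<theta> * x)\<close>, which is bounded below by a positive number and tends to
  infinity at both ends. Since \<open>A\<close> and \<open>L\<close> do not depend on \<open>\<epsilon>\<close>, letting \<open>\<epsilon> \<rightarrow> 0\<close> gives the claim
  (\<open>classical_solution_decay\<close>).

  It remains to see that a strong solution is classical enough for this argument
  (\<open>strong_CH_solution_classical\<close>). For a continuous function in \<open>H\<^sup>r\<close>, \<open>r > 1/2\<close>, the Fourier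
  inversion formula holds at every point, so the \<open>H\<^sup>r\<close> norm controls the supremum, and for
  \<open>r > 3/2\<close> it controls the derivative as well. With \<open>r = s\<close> this gives uniform bounds and
  continuity in time. With \<open>r = s - 1\<close>, applied to the time difference quotients, it gives the
  time derivative of \<open>u\<close> at every point, because the equation provides a continuous representative
  of \<open>\<partial>\<^sub>t u\<close>.
\<close>

section \<open>Square-integrable functions and the Fourier--Plancherel transform\<close>

lemma norm_lincomb_sq_le:
  fixes x y :: "'a::real_normed_vector"
  shows "(norm (a *\<^sub>R x + b *\<^sub>R y))\<^sup>2 \<le> 2 * a\<^sup>2 * (norm x)\<^sup>2 + 2 * b\<^sup>2 * (norm y)\<^sup>2"
proof -
  have "norm (a *\<^sub>R x + b *\<^sub>R y) \<le> \<bar>a\<bar> * norm x + \<bar>b\<bar> * norm y"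
    using norm_triangle_ineq[of "a *\<^sub>R x" "b *\<^sub>R y"] by simp
  then have "(norm (a *\<^sub>R x + b *\<^sub>R y))\<^sup>2 \<le> (\<bar>a\<bar> * norm x + \<bar>b\<bar> * norm y)\<^sup>2"
    by (intro power_mono) auto
  also have "\<dots> \<le> 2 * (\<bar>a\<bar> * norm x)\<^sup>2 + 2 * (\<bar>b\<bar> * norm y)\<^sup>2"
    using zero_le_power2[of "\<bar>a\<bar> * norm x - \<bar>b\<bar> * norm y"]
    unfolding power2_sum power2_diff by linarith
  finally show ?thesis by (simp add: power_mult_distrib)
qed

lemma square_integrable_lincomb:
  fixes f h :: "real \<Rightarrow> 'a::{real_normed_vector, second_countable_topology}"
  assumes "square_integrable f" "square_integrable h"
  shows "square_integrable (\<lambda>x. a *\<^sub>R f x + b *\<^sub>R h x)"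
proof -
  have [measurable]: "f \<in> borel_measurable lborel" "h \<in> borel_measurable lborel"
    using assms by (auto simp: square_integrable_def)
  have "integrable lborel (\<lambda>x. 2 * a\<^sup>2 * (norm (f x))\<^sup>2 + 2 * b\<^sup>2 * (norm (h x))\<^sup>2)"
    using assms by (auto simp: square_integrable_def)
  then have "integrable lborel (\<lambda>x. (norm (a *\<^sub>R f x + b *\<^sub>R h x))\<^sup>2)"
    by (rule Bochner_Integration.integrable_bound) (auto intro!: AE_I2 order_trans[OF norm_lincomb_sq_le])
  then show ?thesis by (auto simp: square_integrable_def)
qed

lemma integrable_mult_square_integrable:
  fixes f g :: "real \<Rightarrow> 'a::{real_normed_algebra, banach, second_countable_topology}"
  assumes "square_integrable f" "square_integrable g"
  shows "integrable lborel (\<lambda>x. f x * g x)"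
proof -
  have [measurable]: "f \<in> borel_measurable lborel" "g \<in> borel_measurable lborel"
    using assms by (auto simp: square_integrable_def)
  have "norm (f x * g x) \<le> (norm (f x))\<^sup>2 + (norm (g x))\<^sup>2" for x
    using norm_mult_ineq[of "f x" "g x"] zero_le_power2[of "norm (f x) - norm (g x)"]
      zero_le_power2[of "norm (f x)"] zero_le_power2[of "norm (g x)"]
    unfolding power2_diff by linarith
  moreover have "integrable lborel (\<lambda>x. (norm (f x))\<^sup>2 + (norm (g x))\<^sup>2)"
    using assms by (auto simp: square_integrable_def)
  ultimately show ?thesis
    by (intro Bochner_Integration.integrable_bound[OF \<open>integrable lborel (\<lambda>x. (norm (f x))\<^sup>2 + (norm (g x))\<^sup>2)\<close>]) (auto intro!: AE_I2)
qed

lemma integrable_on_interval_square_integrable: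
  fixes f :: "real \<Rightarrow> real"
  assumes "square_integrable f"
  shows "set_integrable lborel {-R..R} f"
proof -
  have "square_integrable (indicator {-R..R} :: real \<Rightarrow> real)"
    by (simp add: square_integrable_def power2_eq_square integrable_real_indicator emeasure_lborel_Icc_eq
        flip: indicator_inter_arith)
  from integrable_mult_square_integrable[OF this assms] show ?thesis
    by (simp add: set_integrable_def)
qed

lemma Cauchy_Schwarz_integral:
  fixes f g :: "real \<Rightarrow> real"
  assumes "square_integrable f" "square_integrable g"
  shows "(LINT x|lborel. \<bar>f x\<bar> * \<bar>g x\<bar>) \<le> sqrt (LINT x|lborel. (f x)\<^sup>2) * sqrt (LINT x|lborel. (g x)\<^sup>2)"
proof -
  have [measurable]: "f \<in> borel_measurable lborel" "g \<in> borel_measurable lborel"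
    and i: "integrable lborel (\<lambda>x. (f x)\<^sup>2)" "integrable lborel (\<lambda>x. (g x)\<^sup>2)"
    using assms by (auto simp: square_integrable_def)
  have ifg: "integrable lborel (\<lambda>x. \<bar>f x\<bar> * \<bar>g x\<bar>)"
    using integrable_mult_square_integrable[OF assms] by (simp flip: abs_mult)
  have "(\<integral>\<^sup>+x. ennreal \<bar>f x\<bar> * ennreal \<bar>g x\<bar> \<partial>lborel)\<^sup>2
      \<le> (\<integral>\<^sup>+x. (ennreal \<bar>f x\<bar>)\<^sup>2 \<partial>lborel) * (\<integral>\<^sup>+x. (ennreal \<bar>g x\<bar>)\<^sup>2 \<partial>lborel)"
    by (rule Cauchy_Schwarz_nn_integral) auto
  then have "ennreal ((LINT x|lborel. \<bar>f x\<bar> * \<bar>g x\<bar>)\<^sup>2) \<le> ennreal ((LINT x|lborel. (f x)\<^sup>2) * (LINT x|lborel. (g x)\<^sup>2))"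
    using i ifg by (simp add: ennreal_mult[symmetric] ennreal_power nn_integral_eq_integral)
  then have "(LINT x|lborel. \<bar>f x\<bar> * \<bar>g x\<bar>)\<^sup>2 \<le> (LINT x|lborel. (f x)\<^sup>2) * (LINT x|lborel. (g x)\<^sup>2)"
    by (simp add: mult_nonneg_nonneg)
  then show ?thesis
    by (metis real_le_rsqrt real_sqrt_mult)
qed

lemma measurable_cis [measurable]: "cis \<in> borel_measurable borel"
  by (intro borel_measurable_continuous_onI continuous_intros)

lemma measurable_truncated_fourier [measurable]:
  assumes [measurable]: "f \<in> borel_measurable lborel"
  shows "truncated_fourier R f \<in> borel_measurable lborel"
  unfolding truncated_fourier_def[abs_def] set_lebesgue_integral_def by measurable

lemma truncated_fourier_lincomb:
  assumes "square_integrable f" "square_integrable h"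
  shows "truncated_fourier R (\<lambda>x. a *\<^sub>R f x + b *\<^sub>R h x) \<xi>
       = a *\<^sub>R truncated_fourier R f \<xi> + b *\<^sub>R truncated_fourier R h \<xi>"
proof -
  have i: "set_integrable lborel {-R..R} (\<lambda>x. complex_of_real (f x) * cis (- (x * \<xi>)))"
    if "square_integrable f" for f
  proof -
    have [measurable]: "f \<in> borel_measurable lborel" using that by (auto simp: square_integrable_def)
    show ?thesis
      using integrable_on_interval_square_integrable[OF that, of R] unfolding set_integrable_def
      by (rule Bochner_Integration.integrable_bound) (auto simp: norm_mult)
  qed
  show ?thesis
    using i[OF assms(1)] i[OF assms(2)]
    by (simp add: truncated_fourier_def algebra_simps set_integral_add
        scaleR_conv_of_real add_divide_distrib flip: set_integral_mult_right)
qed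

lemma is_fourier_transform_lincomb:
  assumes f: "square_integrable f" "square_integrable h"
    and g: "is_fourier_transform f g" "is_fourier_transform h k"
  shows "is_fourier_transform (\<lambda>x. a *\<^sub>R f x + b *\<^sub>R h x) (\<lambda>\<xi>. a *\<^sub>R g \<xi> + b *\<^sub>R k \<xi>)"
proof -
  have [measurable]: "f \<in> borel_measurable lborel" "h \<in> borel_measurable lborel"
    "g \<in> borel_measurable lborel" "k \<in> borel_measurable lborel"
    using assms by (auto simp: square_integrable_def is_fourier_transform_def)
  have sg: "square_integrable (\<lambda>\<xi>. a *\<^sub>R g \<xi> + b *\<^sub>R k \<xi>)"
    using g by (auto simp: is_fourier_transform_def intro: square_integrable_lincomb)
  let ?I = "\<lambda>R. \<integral>\<^sup>+ \<xi>. ennreal ((cmod (truncated_fourier R f \<xi> - g \<xi>))\<^sup>2) \<partial>lborel"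
  let ?J = "\<lambda>R. \<integral>\<^sup>+ \<xi>. ennreal ((cmod (truncated_fourier R h \<xi> - k \<xi>))\<^sup>2) \<partial>lborel"
  have le: "(\<integral>\<^sup>+ \<xi>. ennreal ((cmod (truncated_fourier R (\<lambda>x. a *\<^sub>R f x + b *\<^sub>R h x) \<xi>
      - (a *\<^sub>R g \<xi> + b *\<^sub>R k \<xi>)))\<^sup>2) \<partial>lborel) \<le> ennreal (2 * a\<^sup>2) * ?I R + ennreal (2 * b\<^sup>2) * ?J R" for R
  proof -
    have "(\<integral>\<^sup>+ \<xi>. ennreal ((cmod (truncated_fourier R (\<lambda>x. a *\<^sub>R f x + b *\<^sub>R h x) \<xi>
      - (a *\<^sub>R g \<xi> + b *\<^sub>R k \<xi>)))\<^sup>2) \<partial>lborel) \<le>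
      (\<integral>\<^sup>+ \<xi>. ennreal (2 * a\<^sup>2) * ennreal ((cmod (truncated_fourier R f \<xi> - g \<xi>))\<^sup>2)
         + ennreal (2 * b\<^sup>2) * ennreal ((cmod (truncated_fourier R h \<xi> - k \<xi>))\<^sup>2) \<partial>lborel)"
    proof (rule nn_integral_mono)
      fix \<xi>
      have "truncated_fourier R (\<lambda>x. a *\<^sub>R f x + b *\<^sub>R h x) \<xi> - (a *\<^sub>R g \<xi> + b *\<^sub>R k \<xi>)
         = a *\<^sub>R (truncated_fourier R f \<xi> - g \<xi>) + b *\<^sub>R (truncated_fourier R h \<xi> - k \<xi>)"
        unfolding truncated_fourier_lincomb[OF f] by (simp add: algebra_simps)
      then show "ennreal ((cmod (truncated_fourier R (\<lambda>x. a *\<^sub>R f x + b *\<^sub>R h x) \<xi> - (a *\<^sub>R g \<xi> + b *\<^sub>R k \<xi>)))\<^sup>2)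
        \<le> ennreal (2 * a\<^sup>2) * ennreal ((cmod (truncated_fourier R f \<xi> - g \<xi>))\<^sup>2)
         + ennreal (2 * b\<^sup>2) * ennreal ((cmod (truncated_fourier R h \<xi> - k \<xi>))\<^sup>2)"
        using norm_lincomb_sq_le[of a "truncated_fourier R f \<xi> - g \<xi>" b "truncated_fourier R h \<xi> - k \<xi>"]
        by (simp add: ennreal_mult[symmetric] ennreal_plus[symmetric] del: ennreal_plus)
    qed
    also have "\<dots> = ennreal (2 * a\<^sup>2) * ?I R + ennreal (2 * b\<^sup>2) * ?J R"
      by (subst nn_integral_add) (auto simp: nn_integral_cmult)
    finally show ?thesis .
  qed
  have "((\<lambda>R. ennreal (2 * a\<^sup>2) * ?I R + ennreal (2 * b\<^sup>2) * ?J R) \<longlongrightarrow> ennreal (2 * a\<^sup>2) * 0 + ennreal (2 * b\<^sup>2) * 0) at_top"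
    using g by (intro tendsto_add tendsto_mult_ennreal tendsto_const) (auto simp: is_fourier_transform_def)
  then have "((\<lambda>R. ennreal (2 * a\<^sup>2) * ?I R + ennreal (2 * b\<^sup>2) * ?J R) \<longlongrightarrow> 0) at_top" by simp
  from tendsto_sandwich[OF always_eventually always_eventually tendsto_const this] sg le show ?thesis
    unfolding is_fourier_transform_def by auto
qed

text \<open>
  Two limits in \<open>L\<^sup>2\<close> of the same family: their difference is a transform of \<open>f - f = 0\<close>.
\<close>
lemma is_fourier_transform_unique:
  assumes f: "square_integrable f"
    and g: "is_fourier_transform f g" "is_fourier_transform f k"
  shows "AE \<xi> in lborel. g \<xi> = k \<xi>"
proof -
  have [measurable]: "g \<in> borel_measurable lborel" "k \<in> borel_measurable lborel"
    using assms by (auto simp: square_integrable_def is_fourier_transform_def)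
  have "truncated_fourier R (\<lambda>x. 0) \<xi> = 0" for R \<xi>
    by (simp add: truncated_fourier_def set_lebesgue_integral_def)
  with is_fourier_transform_lincomb[OF f f g, of 1 "-1"]
  have "((\<lambda>R::real. \<integral>\<^sup>+ \<xi>. ennreal ((cmod (g \<xi> - k \<xi>))\<^sup>2) \<partial>lborel) \<longlongrightarrow> 0) at_top"
    by (simp add: is_fourier_transform_def norm_minus_commute)
  then have "(\<integral>\<^sup>+ \<xi>. ennreal ((cmod (g \<xi> - k \<xi>))\<^sup>2) \<partial>lborel) = 0"
    by (simp add: tendsto_const_iff)
  then have "AE \<xi> in lborel. ennreal ((cmod (g \<xi> - k \<xi>))\<^sup>2) = 0"
    by (subst (asm) nn_integral_0_iff_AE) auto
  then show ?thesis by eventually_elim simp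
qed

lemma is_fourier_transform_cong_AE:
  assumes "f \<in> borel_measurable lborel" "h \<in> borel_measurable lborel" "AE x in lborel. f x = h x"
  shows "is_fourier_transform f = is_fourier_transform h"
proof -
  have "truncated_fourier R f = truncated_fourier R h" for R
  proof
    fix \<xi>
    have "(LINT x:{-R..R}|lborel. complex_of_real (f x) * cis (- (x * \<xi>)))
      = (LINT x:{-R..R}|lborel. complex_of_real (h x) * cis (- (x * \<xi>)))"
      unfolding set_lebesgue_integral_def
      by (rule integral_cong_AE) (use assms in auto)
    then show "truncated_fourier R f \<xi> = truncated_fourier R h \<xi>"
      by (simp add: truncated_fourier_def)
  qed
  then show ?thesis by (auto simp: is_fourier_transform_def fun_eq_iff)
qed

section \<open>Fourier inversion by Gaussian summation\<close>

lemma integrable_gaussian: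
  "integrable lborel (\<lambda>x::real. exp (- x\<^sup>2 / 2))"
proof -
  have "integrable lborel (\<lambda>x. sqrt (2 * pi) * std_normal_density x)"
    by (intro integrable_mult_right integrable_normal_density) auto
  then show ?thesis by (simp add: std_normal_density_def)
qed

lemma integrable_scaled_gaussian:
  assumes "c \<noteq> 0"
  shows "integrable lborel (\<lambda>x::real. exp (- (c * (t - x))\<^sup>2 / 2))"
proof -
  have "integrable lborel (\<lambda>x::real. exp (- (c * t + (- c) * x)\<^sup>2 / 2))"
    using integrable_gaussian assms
    by (subst lborel_integrable_real_affine_iff[where f="\<lambda>x. exp (- x\<^sup>2 / 2)"]) auto
  then show ?thesis by (simp add: algebra_simps)
qed

lemma square_integrable_scaled_gaussian:
  assumes "c \<noteq> 0"
  shows "square_integrable (\<lambda>x::real. exp (- (c * (t - x))\<^sup>2 / 2))"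
proof -
  have "integrable lborel (\<lambda>x::real. exp (- (c * (t - x))\<^sup>2))"
    using integrable_scaled_gaussian[of "c * sqrt 2" t] assms
    by (simp add: power_mult_distrib)
  then show ?thesis by (simp add: square_integrable_def flip: exp_double)
qed

text \<open>
  The characteristic function of the standard normal distribution, rescaled.
\<close>
lemma integral_cis_gaussian:
  assumes "n > 0"
  shows "(LINT \<xi>|lborel. cis (t * \<xi>) * of_real (exp (- (\<xi> / n)\<^sup>2 / 2)))
       = of_real (sqrt (2 * pi) * (n * exp (- (n * t)\<^sup>2 / 2)))"
proof -
  have std: "(LINT \<xi>|lborel. cis (t * \<xi>) * of_real (exp (- \<xi>\<^sup>2 / 2)))
      = of_real (sqrt (2 * pi) * exp (- t\<^sup>2 / 2))" for t
  proof -
    have "of_real (exp (- t\<^sup>2 / 2)) = (CLINT \<xi>|std_normal_distribution. iexp (t * \<xi>))"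
      using fun_cong[OF char_std_normal_distribution, of t] by (simp add: char_def)
    also have "\<dots> = (LINT \<xi>|lborel. std_normal_density \<xi> *\<^sub>R iexp (t * \<xi>))"
      by (subst integral_density) (auto simp: normal_density_nonneg)
    also have "\<dots> = (LINT \<xi>|lborel. of_real (1 / sqrt (2 * pi)) * (cis (t * \<xi>) * of_real (exp (- \<xi>\<^sup>2 / 2))))"
      by (rule Bochner_Integration.integral_cong)
        (auto simp: std_normal_density_def scaleR_conv_of_real cis_conv_exp)
    also have "\<dots> = of_real (1 / sqrt (2 * pi)) * (LINT \<xi>|lborel. cis (t * \<xi>) * of_real (exp (- \<xi>\<^sup>2 / 2)))"
      by (rule integral_mult_right_zero)
    finally show ?thesis by (simp add: field_simps)
  qed
  have "(LINT \<xi>|lborel. cis (t * \<xi>) * of_real (exp (- (\<xi> / n)\<^sup>2 / 2)))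
     = \<bar>n\<bar> *\<^sub>R (LINT \<xi>|lborel. cis (t * (0 + n * \<xi>)) * of_real (exp (- ((0 + n * \<xi>) / n)\<^sup>2 / 2)))"
    by (rule lborel_integral_real_affine) (use assms in auto)
  also have "\<dots> = n *\<^sub>R (LINT \<xi>|lborel. cis ((t * n) * \<xi>) * of_real (exp (- \<xi>\<^sup>2 / 2)))"
    using assms by (simp add: mult_ac)
  finally show ?thesis unfolding std using assms by (simp add: scaleR_conv_of_real mult_ac)
qed

text \<open>
  The multiplication formula \<open>\<integral> f\<^sup>^ k = \<integral> f k\<^sup>^\<close> for a modulated Gaussian \<open>k\<close>. Truncating \<open>f\<close> makes it
  integrable, so that Fubini's theorem applies.
\<close>
lemma truncated_fourier_gaussian:
  assumes f: "square_integrable f" and n: "n > 0"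
  shows "(LINT \<xi>|lborel. truncated_fourier R f \<xi> * (cis (x * \<xi>) * of_real (exp (- (\<xi> / n)\<^sup>2 / 2))))
    = of_real (LINT y:{-R..R}|lborel. f y * (n * exp (- (n * (x - y))\<^sup>2 / 2)))"
proof -
  have [measurable]: "f \<in> borel_measurable lborel" "f \<in> borel_measurable borel" using f by (auto simp: square_integrable_def)
  define e where "e \<xi> = exp (- (\<xi> / n)\<^sup>2 / 2)" for \<xi>
  have ie: "integrable lborel e"
    using integrable_scaled_gaussian[of "1/n" 0] n by (simp add: e_def[abs_def] power_divide)
  have [measurable]: "e \<in> borel_measurable borel" using ie by auto
  define F where "F y = indicator {-R..R} y * f y" for y
  have [measurable]: "F \<in> borel_measurable borel" by (simp add: F_def[abs_def])
  have iF: "integrable lborel F"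
    using integrable_on_interval_square_integrable[OF f, of R] by (simp add: F_def[abs_def] set_integrable_def)
  define H :: "real \<Rightarrow> real \<Rightarrow> complex" where "H \<xi> y = of_real (F y) * (cis ((x - y) * \<xi>) * of_real (e \<xi>))" for \<xi> y
  have nH: "norm (H \<xi> y) = \<bar>F y\<bar> * e \<xi>" for \<xi> y
    by (simp add: H_def norm_mult e_def)
  have iH: "integrable (lborel \<Otimes>\<^sub>M lborel) (case_prod H)"
  proof (rule lborel_pair.Fubini_integrable)
    show "case_prod H \<in> borel_measurable (lborel \<Otimes>\<^sub>M lborel)"
      unfolding H_def[abs_def] by measurable
    show "integrable lborel (\<lambda>\<xi>. LINT y|lborel. norm (case_prod H (\<xi>, y)))"
      using ie by (simp add: nH)
    have "integrable lborel (H \<xi>)" for \<xi>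
    proof (rule Bochner_Integration.integrable_bound)
      show "integrable lborel (\<lambda>y. \<bar>F y\<bar> * e \<xi>)" using iF by auto
      show "H \<xi> \<in> borel_measurable lborel" unfolding H_def[abs_def] by measurable
    qed (auto simp: nH)
    then show "AE \<xi> in lborel. integrable lborel (\<lambda>y. case_prod H (\<xi>, y))" by simp
  qed
  have "(LINT \<xi>|lborel. truncated_fourier R f \<xi> * (cis (x * \<xi>) * of_real (e \<xi>)))
      = (LINT \<xi>|lborel. (LINT y|lborel. H \<xi> y) / of_real (sqrt (2 * pi)))"
  proof (rule Bochner_Integration.integral_cong[OF refl])
    fix \<xi>
    have "truncated_fourier R f \<xi> * (cis (x * \<xi>) * of_real (e \<xi>))
      = (LINT y|lborel. (indicator {-R..R} y *\<^sub>R (of_real (f y) * cis (- (y * \<xi>)))) * (cis (x * \<xi>) * of_real (e \<xi>))) / of_real (sqrt (2 * pi))"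
      by (subst integral_mult_left_zero) (simp add: truncated_fourier_def set_lebesgue_integral_def)
    also have "(\<lambda>y. (indicator {-R..R} y *\<^sub>R (of_real (f y) * cis (- (y * \<xi>)))) * (cis (x * \<xi>) * of_real (e \<xi>))) = H \<xi>"
    proof
      fix y
      have "cis ((x - y) * \<xi>) = cis (- (y * \<xi>)) * cis (x * \<xi>)"
        by (simp add: cis_mult algebra_simps)
      then show "(indicator {-R..R} y *\<^sub>R (of_real (f y) * cis (- (y * \<xi>)))) * (cis (x * \<xi>) * of_real (e \<xi>)) = H \<xi> y"
        by (simp add: H_def F_def scaleR_conv_of_real)
    qed
    finally show "truncated_fourier R f \<xi> * (cis (x * \<xi>) * of_real (e \<xi>)) = (LINT y|lborel. H \<xi> y) / of_real (sqrt (2 * pi))" .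
  qed
  also have "\<dots> = (LINT \<xi>|lborel. (LINT y|lborel. H \<xi> y)) / of_real (sqrt (2 * pi))"
    by (rule integral_divide_zero)
  also have "(LINT \<xi>|lborel. (LINT y|lborel. H \<xi> y)) = (LINT y|lborel. (LINT \<xi>|lborel. H \<xi> y))"
    by (rule lborel_pair.Fubini_integral[OF iH, symmetric])
  also have "\<dots> = (LINT y|lborel. of_real (F y * (sqrt (2 * pi) * (n * exp (- (n * (x - y))\<^sup>2 / 2)))))"
    by (rule Bochner_Integration.integral_cong[OF refl])
      (use integral_cis_gaussian[OF n] in \<open>simp add: H_def e_def\<close>)
  also have "\<dots> = of_real (LINT y|lborel. sqrt (2 * pi) * (F y * (n * exp (- (n * (x - y))\<^sup>2 / 2))))"
    by (subst integral_complex_of_real) (simp add: mult_ac)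
  also have "\<dots> = of_real (sqrt (2 * pi)) * of_real (LINT y|lborel. (F y * (n * exp (- (n * (x - y))\<^sup>2 / 2))))"
    by simp
  finally show ?thesis by (simp add: e_def F_def set_lebesgue_integral_def mult_ac)
qed

text \<open>
  Both sides of the truncated identity converge as the truncation is removed: the left one by the
  Cauchy--Schwarz inequality, since the transforms converge in \<open>L\<^sup>2\<close>, the right one by dominated
  convergence.
\<close>
lemma fourier_gaussian_pairing:
  assumes f: "square_integrable f" and g: "is_fourier_transform f g" and n: "n > 0"
  shows "(LINT \<xi>|lborel. g \<xi> * (cis (x * \<xi>) * of_real (exp (- (\<xi> / n)\<^sup>2 / 2))))
    = of_real (LINT y|lborel. f y * (n * exp (- (n * (x - y))\<^sup>2 / 2)))"
proof -
  have [measurable]: "f \<in> borel_measurable lborel" "g \<in> borel_measurable lborel" and sg: "square_integrable g"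
    using f g by (auto simp: square_integrable_def is_fourier_transform_def)
  define k where "k \<xi> = cis (x * \<xi>) * of_real (exp (- (\<xi> / n)\<^sup>2 / 2))" for \<xi>
  have [measurable]: "k \<in> borel_measurable borel" unfolding k_def[abs_def] by measurable
  have nk: "norm (k \<xi>) = exp (- (\<xi> / n)\<^sup>2 / 2)" for \<xi> by (simp add: k_def norm_mult)
  have ik: "integrable lborel k"
    by (rule Bochner_Integration.integrable_bound[OF integrable_scaled_gaussian[of "1/n" 0]]) (use n in \<open>auto simp: nk power_divide\<close>)
  have sk: "square_integrable k"
    using square_integrable_scaled_gaussian[of "1/n" 0] n by (simp add: square_integrable_def nk power_divide)
  let ?t = "truncated_fourier"
  have itk: "integrable lborel (\<lambda>\<xi>. ?t R f \<xi> * k \<xi>)" for R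
  proof (rule Bochner_Integration.integrable_bound)
    define B where "B = (LINT x:{-R..R}|lborel. \<bar>f x\<bar>) / sqrt (2 * pi)"
    have B: "norm (?t R f \<xi>) \<le> B" for \<xi>
    proof -
      have "norm (LINT x:{-R..R}|lborel. complex_of_real (f x) * cis (- (x * \<xi>))) \<le> (LINT x:{-R..R}|lborel. norm (complex_of_real (f x) * cis (- (x * \<xi>))))"
        unfolding set_lebesgue_integral_def by (rule order_trans[OF integral_norm_bound]) simp
      then show ?thesis by (simp add: truncated_fourier_def B_def norm_divide norm_mult divide_right_mono)
    qed
    show "integrable lborel (\<lambda>\<xi>. B * norm (k \<xi>))" using ik by auto
    show "AE \<xi> in lborel. norm (?t R f \<xi> * k \<xi>) \<le> norm (B * norm (k \<xi>))"
      using B by (auto simp: norm_mult abs_mult intro!: AE_I2 mult_right_mono order_trans[OF B])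
  qed measurable
  have igk: "integrable lborel (\<lambda>\<xi>. g \<xi> * k \<xi>)"
    by (rule integrable_mult_square_integrable[OF sg sk])
  let ?I = "\<lambda>R. \<integral>\<^sup>+ \<xi>. ennreal ((cmod (?t R f \<xi> - g \<xi>))\<^sup>2) \<partial>lborel"
  define K where "K = (\<integral>\<^sup>+ \<xi>. ennreal ((norm (k \<xi>))\<^sup>2) \<partial>lborel)"
  have Kfin: "K < top" using sk by (auto simp: K_def square_integrable_def nn_integral_eq_integral)
  have le: "ennreal ((norm ((LINT \<xi>|lborel. ?t R f \<xi> * k \<xi>) - (LINT \<xi>|lborel. g \<xi> * k \<xi>)))\<^sup>2) \<le> ?I R * K" for R
  proof -
    have "ennreal (norm ((LINT \<xi>|lborel. ?t R f \<xi> * k \<xi>) - (LINT \<xi>|lborel. g \<xi> * k \<xi>)))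
       = ennreal (norm (LINT \<xi>|lborel. ?t R f \<xi> * k \<xi> - g \<xi> * k \<xi>))"
      using itk igk by simp
    also have "\<dots> \<le> (\<integral>\<^sup>+ \<xi>. ennreal (norm (?t R f \<xi> * k \<xi> - g \<xi> * k \<xi>)) \<partial>lborel)"
      using itk igk by (intro integral_norm_bound_ennreal) auto
    also have "\<dots> = (\<integral>\<^sup>+ \<xi>. ennreal (norm (?t R f \<xi> - g \<xi>)) * ennreal (norm (k \<xi>)) \<partial>lborel)"
      by (simp add: ennreal_mult[symmetric] norm_mult flip: left_diff_distrib)
    finally have "(ennreal (norm ((LINT \<xi>|lborel. ?t R f \<xi> * k \<xi>) - (LINT \<xi>|lborel. g \<xi> * k \<xi>))))\<^sup>2
       \<le> (\<integral>\<^sup>+ \<xi>. ennreal (norm (?t R f \<xi> - g \<xi>)) * ennreal (norm (k \<xi>)) \<partial>lborel)\<^sup>2"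
      by (intro power_mono) auto
    also have "\<dots> \<le> (\<integral>\<^sup>+ \<xi>. (ennreal (norm (?t R f \<xi> - g \<xi>)))\<^sup>2 \<partial>lborel) * (\<integral>\<^sup>+ \<xi>. (ennreal (norm (k \<xi>)))\<^sup>2 \<partial>lborel)"
      by (rule Cauchy_Schwarz_nn_integral) auto
    finally show ?thesis by (simp add: ennreal_power K_def)
  qed
  have "((\<lambda>R. ?I R * K) \<longlongrightarrow> 0 * K) at_top"
    using g Kfin by (intro tendsto_mult_ennreal tendsto_const) (auto simp: is_fourier_transform_def)
  then have "((\<lambda>R. ?I R * K) \<longlongrightarrow> 0) at_top" by simp
  from tendsto_sandwich[OF always_eventually always_eventually tendsto_const this]
  have "((\<lambda>R. ennreal ((norm ((LINT \<xi>|lborel. ?t R f \<xi> * k \<xi>) - (LINT \<xi>|lborel. g \<xi> * k \<xi>)))\<^sup>2)) \<longlongrightarrow> ennreal 0) at_top"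
    using le by auto
  then have "((\<lambda>R. (norm ((LINT \<xi>|lborel. ?t R f \<xi> * k \<xi>) - (LINT \<xi>|lborel. g \<xi> * k \<xi>)))\<^sup>2) \<longlongrightarrow> 0) at_top"
    by (subst (asm) tendsto_ennreal_iff) auto
  from tendsto_real_sqrt[OF this]
  have "((\<lambda>R. (LINT \<xi>|lborel. ?t R f \<xi> * k \<xi>) - (LINT \<xi>|lborel. g \<xi> * k \<xi>)) \<longlongrightarrow> 0) at_top"
    by (simp add: tendsto_norm_zero_iff)
  then have lim1: "((\<lambda>R. LINT \<xi>|lborel. ?t R f \<xi> * k \<xi>) \<longlongrightarrow> (LINT \<xi>|lborel. g \<xi> * k \<xi>)) at_top"
    by (simp add: LIM_zero_iff)
  define h where "h y = f y * (n * exp (- (n * (x - y))\<^sup>2 / 2))" for y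
  have ih: "integrable lborel h"
    using integrable_mult_square_integrable[OF f square_integrable_scaled_gaussian[of n x], THEN integrable_mult_right, of n] n
    by (simp add: h_def[abs_def] mult_ac)
  have [measurable]: "h \<in> borel_measurable lborel" using ih by auto
  have lim2: "((\<lambda>R. LINT y:{-R..R}|lborel. h y) \<longlongrightarrow> (LINT y|lborel. h y)) at_top"
    unfolding set_lebesgue_integral_def
  proof (rule integral_dominated_convergence_at_top)
    show "integrable lborel (\<lambda>y. norm (h y))" using ih by auto
    show "AE y in lborel. ((\<lambda>R. indicat_real {-R..R} y *\<^sub>R h y) \<longlongrightarrow> h y) at_top"
    proof (rule AE_I2)
      fix y
      have "\<forall>\<^sub>F R in at_top. indicat_real {-R..R} y *\<^sub>R h y = h y"
        using eventually_ge_at_top[of "\<bar>y\<bar>"] by eventually_elim (auto simp: indicator_def)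
      then show "((\<lambda>R. indicat_real {-R..R} y *\<^sub>R h y) \<longlongrightarrow> h y) at_top" by (rule tendsto_eventually)
    qed
    show "\<forall>\<^sub>F R in at_top. AE y in lborel. norm (indicat_real {-R..R} y *\<^sub>R h y) \<le> norm (h y)"
      by (auto simp: indicator_def)
  qed auto
  have "(LINT \<xi>|lborel. ?t R f \<xi> * k \<xi>) = of_real (LINT y:{-R..R}|lborel. h y)" for R
    unfolding k_def h_def by (rule truncated_fourier_gaussian[OF f n])
  with lim1 have "((\<lambda>R. of_real (LINT y:{-R..R}|lborel. h y)) \<longlongrightarrow> (LINT \<xi>|lborel. g \<xi> * k \<xi>)) at_top"
    by simp
  from tendsto_unique[OF _ this tendsto_of_real[OF lim2]] show ?thesis
    by (simp add: k_def h_def)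
qed

text \<open>
  Since \<open>f\<close> may be unbounded, it is cut at distance \<open>1\<close> from \<open>x\<close>. The near part is bounded and
  converges after rescaling. In the far part half of the Gaussian exponent is spent on a factor
  that tends to \<open>0\<close>, and the other half keeps the integrand integrable.
\<close>
lemma gaussian_mollifier_tendsto:
  assumes f: "square_integrable f" and c: "continuous_on UNIV f"
  shows "(\<lambda>m. LINT y|lborel. f y * (real (Suc m) * exp (- (real (Suc m) * (x - y))\<^sup>2 / 2)))
       \<longlonglongrightarrow> sqrt (2 * pi) * f x"
proof -
  have [measurable]: "f \<in> borel_measurable lborel" "f \<in> borel_measurable borel" using f by (auto simp: square_integrable_def)
  define f1 where "f1 y = indicator {x-1..x+1} y * f y" for y
  define f2 where "f2 y = indicator (- {x-1..x+1}) y * f y" for y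
  define r where "r m y = real (Suc m) * exp (- (real (Suc m) * (x - y))\<^sup>2 / 2)" for m y
  have [measurable]: "f1 \<in> borel_measurable borel" "f2 \<in> borel_measurable borel"
    unfolding f1_def[abs_def] f2_def[abs_def] by measurable
  obtain B where B: "\<And>y. y \<in> {x-1..x+1} \<Longrightarrow> \<bar>f y\<bar> \<le> B"
  proof -
    have "compact (f ` {x-1..x+1})"
      by (intro compact_continuous_image continuous_on_subset[OF c]) auto
    then have "bounded (f ` {x-1..x+1})" by (rule compact_imp_bounded)
    then obtain a where "\<forall>z\<in>f ` {x-1..x+1}. norm z \<le> a" unfolding bounded_iff by blast
    then show ?thesis by (intro that[of a]) auto
  qed
  have B0: "B \<ge> 0" using B[of x] by auto
  have f1B: "\<bar>f1 y\<bar> \<le> B" for y using B[of y] B0 by (auto simp: f1_def indicator_def)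
  have int_r: "integrable lborel (\<lambda>y. f y * r m y)" for m
    using integrable_mult_square_integrable[OF f square_integrable_scaled_gaussian[of "real (Suc m)" x], THEN integrable_mult_right, of "real (Suc m)"]
    by (simp add: r_def[abs_def] mult_ac)
  have int1: "integrable lborel (\<lambda>y. f1 y * r m y)" and int2: "integrable lborel (\<lambda>y. f2 y * r m y)" for m
    by (rule Bochner_Integration.integrable_bound[OF int_r[of m]]; auto simp: f1_def f2_def r_def abs_mult indicator_def intro!: AE_I2)+
  have eq: "(LINT y|lborel. f y * r m y) = (LINT y|lborel. f1 y * r m y) + (LINT y|lborel. f2 y * r m y)" for m
  proof -
    have "f y * r m y = f1 y * r m y + f2 y * r m y" for y
      by (auto simp: f1_def f2_def indicator_def)
    then show ?thesis using int1 int2 by simp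
  qed
  have lim1: "(\<lambda>m. LINT y|lborel. f1 y * r m y) \<longlonglongrightarrow> sqrt (2 * pi) * f x"
  proof -
    have e1: "(LINT y|lborel. f1 y * r m y) = (LINT z|lborel. f1 (x + z / real (Suc m)) * exp (- z\<^sup>2 / 2))" for m
    proof -
      have "(LINT y|lborel. f1 y * r m y) = \<bar>1 / real (Suc m)\<bar> *\<^sub>R (LINT z|lborel. f1 (x + (1 / real (Suc m)) * z) * r m (x + (1 / real (Suc m)) * z))"
        by (rule lborel_integral_real_affine) simp
      also have "\<dots> = (LINT z|lborel. (1 / real (Suc m)) * (f1 (x + (1 / real (Suc m)) * z) * r m (x + (1 / real (Suc m)) * z)))"
        by simp
      also have "\<dots> = (LINT z|lborel. f1 (x + z / real (Suc m)) * exp (- z\<^sup>2 / 2))"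
        by (rule Bochner_Integration.integral_cong) (auto simp: r_def simp del: of_nat_Suc)
      finally show ?thesis .
    qed
    have "(\<lambda>m. LINT z|lborel. f1 (x + z / real (Suc m)) * exp (- z\<^sup>2 / 2)) \<longlonglongrightarrow> (LINT z|lborel. f x * exp (- z\<^sup>2 / 2))"
    proof (rule integral_dominated_convergence)
      show "integrable lborel (\<lambda>z::real. B * exp (- z\<^sup>2 / 2))" using integrable_gaussian by auto
      show "AE z in lborel. norm (f1 (x + z / real (Suc m)) * exp (- z\<^sup>2 / 2)) \<le> B * exp (- z\<^sup>2 / 2)" for m
        by (auto simp: abs_mult intro!: AE_I2 f1B)
      show "AE z in lborel. (\<lambda>m. f1 (x + z / real (Suc m)) * exp (- z\<^sup>2 / 2)) \<longlonglongrightarrow> f x * exp (- z\<^sup>2 / 2)"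
      proof (intro AE_I2 tendsto_mult tendsto_const)
        fix z :: real
        have z: "(\<lambda>m. x + z / real (Suc m)) \<longlonglongrightarrow> x" by real_asymp
        have "isCont f x" using c by (simp add: continuous_on_eq_continuous_at)
        then have "(\<lambda>m. f (x + z / real (Suc m))) \<longlonglongrightarrow> f x" by (rule isCont_tendsto_compose[OF _ z])
        moreover have "\<forall>\<^sub>F m in sequentially. x + z / real (Suc m) \<in> {x-1<..<x+1}"
          using z by (rule topological_tendstoD) auto
        then have "\<forall>\<^sub>F m in sequentially. f (x + z / real (Suc m)) = f1 (x + z / real (Suc m))"
          by eventually_elim (auto simp: f1_def)
        ultimately show "(\<lambda>m. f1 (x + z / real (Suc m))) \<longlonglongrightarrow> f x"
          by (rule Lim_transform_eventually)
      qed
    qed auto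
    moreover have "(LINT z|lborel. f x * exp (- z\<^sup>2 / 2)) = sqrt (2 * pi) * f x"
      using integral_cis_gaussian[of 1 0]
      by (simp add: integral_complex_of_real del: of_real_exp)
    ultimately show ?thesis unfolding e1 by (simp only:)
  qed
  have lim2: "(\<lambda>m. LINT y|lborel. f2 y * r m y) \<longlonglongrightarrow> 0"
  proof -
    define J where "J = (LINT y|lborel. \<bar>f y\<bar> * exp (- ((1 / sqrt 2) * (x - y))\<^sup>2 / 2))"
    have iJ: "integrable lborel (\<lambda>y. \<bar>f y\<bar> * exp (- ((1 / sqrt 2) * (x - y))\<^sup>2 / 2))"
      using integrable_mult_square_integrable[OF f square_integrable_scaled_gaussian[of "1 / sqrt 2" x], THEN integrable_abs]
      by (simp add: abs_mult)
    have pt: "\<bar>f2 y * r m y\<bar> \<le> (real (Suc m) * exp (- (real (Suc m))\<^sup>2 / 4)) * (\<bar>f y\<bar> * exp (- ((1 / sqrt 2) * (x - y))\<^sup>2 / 2))" for m y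
    proof (cases "y \<in> {x-1..x+1}")
      case True then show ?thesis by (simp add: f2_def)
    next
      case False
      define N where "N = (real (Suc m))\<^sup>2"
      define d where "d = (x - y)\<^sup>2"
      have "1 \<le> \<bar>x - y\<bar>" using False by auto
      then have d: "1 \<le> d" unfolding d_def by (simp add: abs_le_square_iff[of 1, simplified])
      have N: "1 \<le> N" unfolding N_def by simp
      \<comment> \<open>The exponent splits because \<open>N d \<ge> (N + d) / 2\<close> for \<open>N, d \<ge> 1\<close>.\<close>
      have "N * 1 \<le> N * d" "1 * d \<le> N * d" using N d by (auto intro!: mult_left_mono mult_right_mono)
      then have "- (N * d) / 2 \<le> - N / 4 + - d / 4" by (simp add: field_simps)
      then have "exp (- (N * d) / 2) \<le> exp (- N / 4) * exp (- d / 4)"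
        by (simp flip: exp_add)
      then have "\<bar>f y\<bar> * real (Suc m) * exp (- (N * d) / 2) \<le> \<bar>f y\<bar> * real (Suc m) * (exp (- N / 4) * exp (- d / 4))"
        by (intro mult_left_mono) auto
      then show ?thesis using False
        by (simp add: f2_def r_def N_def d_def abs_mult power_mult_distrib power_divide mult_ac del: of_nat_Suc)
    qed
    have bd: "norm (LINT y|lborel. f2 y * r m y) \<le> real (Suc m) * exp (- (real (Suc m))\<^sup>2 / 4) * J" for m
    proof -
      have "norm (LINT y|lborel. f2 y * r m y) \<le> (LINT y|lborel. \<bar>f2 y * r m y\<bar>)"
        using integral_norm_bound[of lborel "\<lambda>y. f2 y * r m y"] by simp
      also have "\<dots> \<le> (LINT y|lborel. (real (Suc m) * exp (- (real (Suc m))\<^sup>2 / 4)) * (\<bar>f y\<bar> * exp (- ((1 / sqrt 2) * (x - y))\<^sup>2 / 2)))"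
        using int2[of m] iJ by (intro integral_mono pt integrable_abs integrable_mult_right) auto
      finally show ?thesis by (simp add: J_def)
    qed
    have "(\<lambda>m. real (Suc m) * exp (- (real (Suc m))\<^sup>2 / 4)) \<longlonglongrightarrow> 0" by real_asymp
    then have "(\<lambda>m. real (Suc m) * exp (- (real (Suc m))\<^sup>2 / 4) * J) \<longlonglongrightarrow> 0"
      by (rule tendsto_mult_left_zero)
    then show ?thesis by (rule Lim_null_comparison[OF always_eventually, rotated]) (use bd in auto)
  qed
  from tendsto_add[OF lim1 lim2] show ?thesis unfolding eq[symmetric] by (simp add: r_def)
qed

text \<open>
  Let \<open>n \<rightarrow> \<infinity>\<close> in \<open>fourier_gaussian_pairing\<close>: the Gaussian kernel concentrates at \<open>x\<close>, while
  the Gaussian factor on the transform side increases to \<open>1\<close>.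
\<close>
lemma fourier_inversion:
  assumes f: "square_integrable f" and c: "continuous_on UNIV f"
    and g: "is_fourier_transform f g" and ig: "integrable lborel g"
  shows "of_real (sqrt (2 * pi) * f x) = (LINT \<xi>|lborel. g \<xi> * cis (x * \<xi>))"
proof -
  have [measurable]: "g \<in> borel_measurable lborel" using ig by auto
  have "(\<lambda>m. LINT \<xi>|lborel. g \<xi> * (cis (x * \<xi>) * of_real (exp (- (\<xi> / real (Suc m))\<^sup>2 / 2))))
     \<longlonglongrightarrow> (LINT \<xi>|lborel. g \<xi> * cis (x * \<xi>))"
  proof (rule integral_dominated_convergence)
    show "integrable lborel (\<lambda>\<xi>. norm (g \<xi>))" using ig by auto
    show "AE \<xi> in lborel. norm (g \<xi> * (cis (x * \<xi>) * of_real (exp (- (\<xi> / real (Suc m))\<^sup>2 / 2)))) \<le> norm (g \<xi>)" for m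
      by (auto simp: norm_mult intro!: AE_I2 mult_left_le)
    show "AE \<xi> in lborel. (\<lambda>m. g \<xi> * (cis (x * \<xi>) * of_real (exp (- (\<xi> / real (Suc m))\<^sup>2 / 2)))) \<longlonglongrightarrow> g \<xi> * cis (x * \<xi>)"
    proof (rule AE_I2)
      fix \<xi> :: real
      have "(\<lambda>m. exp (- (\<xi> / real (Suc m))\<^sup>2 / 2)) \<longlonglongrightarrow> exp (- 0\<^sup>2 / 2)"
        by (intro tendsto_intros) (real_asymp | simp)+
      from tendsto_of_real[OF this]
      have "(\<lambda>m. g \<xi> * (cis (x * \<xi>) * of_real (exp (- (\<xi> / real (Suc m))\<^sup>2 / 2)))) \<longlonglongrightarrow> g \<xi> * (cis (x * \<xi>) * of_real (exp (- 0\<^sup>2 / 2)))"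
        by (intro tendsto_mult tendsto_const)
      then show "(\<lambda>m. g \<xi> * (cis (x * \<xi>) * of_real (exp (- (\<xi> / real (Suc m))\<^sup>2 / 2)))) \<longlonglongrightarrow> g \<xi> * cis (x * \<xi>)" by simp
    qed
  qed auto
  moreover have "(LINT \<xi>|lborel. g \<xi> * (cis (x * \<xi>) * of_real (exp (- (\<xi> / real (Suc m))\<^sup>2 / 2))))
      = of_real (LINT y|lborel. f y * (real (Suc m) * exp (- (real (Suc m) * (x - y))\<^sup>2 / 2)))" for m
    by (rule fourier_gaussian_pairing[OF f g]) simp
  ultimately have "(\<lambda>m. of_real (LINT y|lborel. f y * (real (Suc m) * exp (- (real (Suc m) * (x - y))\<^sup>2 / 2))))
     \<longlonglongrightarrow> (LINT \<xi>|lborel. g \<xi> * cis (x * \<xi>))" by simp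
  from LIMSEQ_unique[OF tendsto_of_real[OF gaussian_mollifier_tendsto[OF f c, of x]] this]
  show ?thesis by simp
qed

section \<open>Sobolev embedding\<close>

text \<open>
  Comparison with \<open>(1 + \<bar>\<xi>\<bar>) powr (- 2 * s)\<close>, which has an explicit primitive.
\<close>
lemma integrable_japanese_bracket:
  assumes "s > 1 / 2"
  shows "integrable lborel (\<lambda>\<xi>::real. (1 + \<xi>\<^sup>2) powr (- s))"
proof -
  define h where "h x = indicator {0..} x * (1 + x) powr (- 2 * s)" for x :: real
  have F: "((\<lambda>x. (1 + x) powr (1 - 2 * s) / (1 - 2 * s)) has_real_derivative (1 + x) powr (- 2 * s)) (at x)" if "0 \<le> x" for x
  proof -
    have "((\<lambda>x. (1 + x) powr (1 - 2 * s)) has_real_derivative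
        (1 - 2 * s) * (1 + x) powr (1 - 2 * s - 1) * 1) (at x)"
      by (rule DERIV_chain2[OF has_real_derivative_powr]) (use that in \<open>auto intro!: derivative_eq_intros\<close>)
    from DERIV_cdivide[OF this, of "1 - 2 * s"] show ?thesis using assms by simp
  qed
  have lim: "((\<lambda>x. (1 + x) powr (1 - 2 * s) / (1 - 2 * s)) \<longlongrightarrow> 0) at_top"
  proof -
    have "((\<lambda>x::real. (1 + x) powr (1 - 2 * s)) \<longlongrightarrow> 0) at_top"
      by (rule tendsto_neg_powr) (use assms in \<open>auto intro!: filterlim_tendsto_add_at_top[OF tendsto_const] filterlim_ident\<close>)
    from tendsto_divide[OF this tendsto_const] show ?thesis using assms by auto
  qed
  have "(\<integral>\<^sup>+x. ennreal ((1 + x) powr (- 2 * s)) * indicator {0..} x \<partial>lborel) = ennreal (0 - (1 + 0) powr (1 - 2 * s) / (1 - 2 * s))"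
    by (rule nn_integral_FTC_atLeast[OF _ F _ lim]) auto
  then have "(\<integral>\<^sup>+x. ennreal (norm (h x)) \<partial>lborel) < \<infinity>"
    by (simp add: h_def abs_mult ennreal_mult' ennreal_indicator mult_ac cong: nn_integral_cong)
  then have ih: "integrable lborel h"
    by (intro integrableI_bounded) (auto simp: h_def[abs_def])
  then have ih': "integrable lborel (\<lambda>x. h (0 + (-1) * x))"
    by (rule lborel_integrable_real_affine) simp
  show ?thesis
  proof (rule Bochner_Integration.integrable_bound)
    show "integrable lborel (\<lambda>x. 2 powr s * (h x + h (- x)))" using ih ih' by auto
    show "AE x in lborel. norm ((1 + x\<^sup>2) powr (- s)) \<le> norm (2 powr s * (h x + h (- x)))"
    proof (rule AE_I2)
      fix x :: real
      have sq: "(1 + \<bar>x\<bar>)\<^sup>2 \<le> 2 * (1 + x\<^sup>2)"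
        using zero_le_power2[of "1 - \<bar>x\<bar>"] unfolding power2_sum power2_diff by simp
      have "(1 + \<bar>x\<bar>) powr (2 * s) = ((1 + \<bar>x\<bar>)\<^sup>2) powr s"
        by (subst powr_powr[symmetric]) (simp add: powr_numeral)
      also have "\<dots> \<le> (2 * (1 + x\<^sup>2)) powr s" using sq assms by (intro powr_mono2) auto
      also have "\<dots> = 2 powr s * (1 + x\<^sup>2) powr s" by (rule powr_mult)
      finally have le: "(1 + \<bar>x\<bar>) powr (2 * s) \<le> 2 powr s * (1 + x\<^sup>2) powr s" .
      have "0 < 1 + x\<^sup>2" by (simp add: add_pos_nonneg)
      then have "0 < (1 + x\<^sup>2) powr s" "0 < (1 + \<bar>x\<bar>) powr (2 * s)" by auto
      with le have "(1 + x\<^sup>2) powr (- s) \<le> 2 powr s * (1 + \<bar>x\<bar>) powr (- (2 * s))"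
        by (simp add: powr_minus divide_simps mult_ac)
      also have "(1 + \<bar>x\<bar>) powr (- (2 * s)) \<le> h x + h (- x)"
        by (auto simp: h_def indicator_def)
      finally show "norm ((1 + x\<^sup>2) powr (- s)) \<le> norm (2 powr s * (h x + h (- x)))"
        by (simp add: h_def)
    qed
  qed auto
qed

lemma has_real_derivative_integral_dominated:
  fixes \<phi> \<phi>' :: "real \<Rightarrow> real \<Rightarrow> real"
  assumes d: "\<And>\<xi> y. (\<phi> \<xi> has_real_derivative \<phi>' \<xi> y) (at y)"
    and w: "\<And>\<xi> y. \<bar>\<phi>' \<xi> y\<bar> \<le> w \<xi>" "integrable lborel w"
    and i: "\<And>y. integrable lborel (\<lambda>\<xi>. \<phi> \<xi> y)"
    and m: "(\<lambda>\<xi>. \<phi>' \<xi> x) \<in> borel_measurable lborel"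
  shows "((\<lambda>y. LINT \<xi>|lborel. \<phi> \<xi> y) has_real_derivative (LINT \<xi>|lborel. \<phi>' \<xi> x)) (at x)"
  unfolding DERIV_def tendsto_at_iff_sequentially comp_def
proof (intro allI impI)
  fix X :: "nat \<Rightarrow> real"
  assume X: "\<forall>n. X n \<in> UNIV - {0}" "X \<longlonglongrightarrow> 0"
  have "(\<lambda>n. LINT \<xi>|lborel. (\<phi> \<xi> (x + X n) - \<phi> \<xi> x) / X n) \<longlonglongrightarrow> (LINT \<xi>|lborel. \<phi>' \<xi> x)"
  proof (rule integral_dominated_convergence)
    show "(\<lambda>\<xi>. (\<phi> \<xi> (x + X n) - \<phi> \<xi> x) / X n) \<in> borel_measurable lborel" for n
      by (intro borel_measurable_divide borel_measurable_diff borel_measurable_const borel_measurable_integrable i)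
    show "AE \<xi> in lborel. (\<lambda>n. (\<phi> \<xi> (x + X n) - \<phi> \<xi> x) / X n) \<longlonglongrightarrow> \<phi>' \<xi> x"
    proof (rule AE_I2)
      fix \<xi>
      have "filterlim X (at 0) sequentially"
        using X by (auto simp: filterlim_at)
      from filterlim_compose[OF d[of \<xi> x, unfolded DERIV_def] this]
      show "(\<lambda>n. (\<phi> \<xi> (x + X n) - \<phi> \<xi> x) / X n) \<longlonglongrightarrow> \<phi>' \<xi> x" .
    qed
    show "AE \<xi> in lborel. norm ((\<phi> \<xi> (x + X n) - \<phi> \<xi> x) / X n) \<le> w \<xi>" for n
    proof (rule AE_I2)
      fix \<xi>
      have "norm (\<phi> \<xi> (x + X n) - \<phi> \<xi> x) \<le> w \<xi> * norm ((x + X n) - x)"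
        by (rule field_differentiable_bound[of UNIV "\<phi> \<xi>" "\<phi>' \<xi>"]) (simp_all add: d w(1))
      then show "norm ((\<phi> \<xi> (x + X n) - \<phi> \<xi> x) / X n) \<le> w \<xi>"
        using X(1) by (simp add: pos_divide_le_eq)
    qed
  qed (rule m w(2))+
  then show "(\<lambda>n. ((LINT \<xi>|lborel. \<phi> \<xi> (x + X n)) - (LINT \<xi>|lborel. \<phi> \<xi> x)) / X n) \<longlonglongrightarrow> (LINT \<xi>|lborel. \<phi>' \<xi> x)"
    by (simp add: Bochner_Integration.integral_diff[OF i i])
qed

lemma continuous_on_integral_dominated:
  fixes \<phi> :: "real \<Rightarrow> real \<Rightarrow> real"
  assumes c: "\<And>\<xi>. continuous_on UNIV (\<phi> \<xi>)"
    and w: "\<And>\<xi> y. \<bar>\<phi> \<xi> y\<bar> \<le> w \<xi>" "integrable lborel w"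
    and m: "\<And>y. (\<lambda>\<xi>. \<phi> \<xi> y) \<in> borel_measurable lborel"
  shows "continuous_on UNIV (\<lambda>y. LINT \<xi>|lborel. \<phi> \<xi> y)"
  unfolding continuous_on_sequentially comp_def
proof (intro allI ballI impI, elim conjE)
  fix X :: "nat \<Rightarrow> real" and x
  assume X: "X \<longlonglongrightarrow> x"
  show "(\<lambda>n. LINT \<xi>|lborel. \<phi> \<xi> (X n)) \<longlonglongrightarrow> (LINT \<xi>|lborel. \<phi> \<xi> x)"
  proof (rule integral_dominated_convergence)
    show "AE \<xi> in lborel. (\<lambda>n. \<phi> \<xi> (X n)) \<longlonglongrightarrow> \<phi> \<xi> x"
    proof (rule AE_I2)
      fix \<xi>
      have "isCont (\<phi> \<xi>) x" using c by (simp add: continuous_on_eq_continuous_at)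
      from isCont_tendsto_compose[OF this X] show "(\<lambda>n. \<phi> \<xi> (X n)) \<longlonglongrightarrow> \<phi> \<xi> x" .
    qed
    show "AE \<xi> in lborel. norm (\<phi> \<xi> (X n)) \<le> w \<xi>" for n by (simp add: w(1))
  qed (rule m w(2))+
qed

text \<open>
  The norm is defined through a choice of transform. Uniqueness almost everywhere makes the weighted
  integral finite for the chosen one too, so the norm is a genuine integral and not a default value.
\<close>
lemma sobolev_norm_realizer:
  assumes "f \<in> sobolev s"
  obtains g where "is_fourier_transform f g"
    "integrable lborel (\<lambda>\<xi>. (1 + \<xi>\<^sup>2) powr s * (cmod (g \<xi>))\<^sup>2)"
    "sobolev_norm s f = sqrt (LINT \<xi>|lborel. (1 + \<xi>\<^sup>2) powr s * (cmod (g \<xi>))\<^sup>2)"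
proof -
  define g where "g = (SOME g. is_fourier_transform f g)"
  obtain k where f: "square_integrable f" and k: "is_fourier_transform f k"
    "integrable lborel (\<lambda>\<xi>. (1 + \<xi>\<^sup>2) powr s * (cmod (k \<xi>))\<^sup>2)"
    using assms by (auto simp: sobolev_def)
  have g: "is_fourier_transform f g" unfolding g_def using k(1) by (rule someI[of "is_fourier_transform f"])
  have [measurable]: "g \<in> borel_measurable lborel"
    using g by (auto simp: square_integrable_def is_fourier_transform_def)
  have "integrable lborel (\<lambda>\<xi>. (1 + \<xi>\<^sup>2) powr s * (cmod (g \<xi>))\<^sup>2)"
    by (rule integrable_cong_AE_imp[OF k(2)]) (use is_fourier_transform_unique[OF f k(1) g] in auto)
  with g show ?thesis by (intro that[of g]) (auto simp: sobolev_norm_def g_def[symmetric])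
qed

lemma sobolev_lincomb:
  assumes f: "f \<in> sobolev s" and h: "h \<in> sobolev s"
  shows "(\<lambda>x. a * f x + b * h x) \<in> sobolev s"
proof -
  obtain g k where g: "is_fourier_transform f g" "integrable lborel (\<lambda>\<xi>. (1 + \<xi>\<^sup>2) powr s * (cmod (g \<xi>))\<^sup>2)"
    and k: "is_fourier_transform h k" "integrable lborel (\<lambda>\<xi>. (1 + \<xi>\<^sup>2) powr s * (cmod (k \<xi>))\<^sup>2)"
    and sq: "square_integrable f" "square_integrable h"
    using f h by (auto simp: sobolev_def)
  have [measurable]: "g \<in> borel_measurable lborel" "k \<in> borel_measurable lborel"
    using g k by (auto simp: square_integrable_def is_fourier_transform_def)
  have "integrable lborel (\<lambda>\<xi>. (1 + \<xi>\<^sup>2) powr s * (cmod (a *\<^sub>R g \<xi> + b *\<^sub>R k \<xi>))\<^sup>2)"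
  proof (rule Bochner_Integration.integrable_bound)
    show "integrable lborel (\<lambda>\<xi>. 2 * a\<^sup>2 * ((1 + \<xi>\<^sup>2) powr s * (cmod (g \<xi>))\<^sup>2) + 2 * b\<^sup>2 * ((1 + \<xi>\<^sup>2) powr s * (cmod (k \<xi>))\<^sup>2))"
      using g k by auto
    have "(1 + \<xi>\<^sup>2) powr s * (cmod (a *\<^sub>R g \<xi> + b *\<^sub>R k \<xi>))\<^sup>2
       \<le> (1 + \<xi>\<^sup>2) powr s * (2 * a\<^sup>2 * (cmod (g \<xi>))\<^sup>2 + 2 * b\<^sup>2 * (cmod (k \<xi>))\<^sup>2)" for \<xi>
      by (intro mult_left_mono norm_lincomb_sq_le) auto
    then show "AE \<xi> in lborel. norm ((1 + \<xi>\<^sup>2) powr s * (cmod (a *\<^sub>R g \<xi> + b *\<^sub>R k \<xi>))\<^sup>2)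
       \<le> norm (2 * a\<^sup>2 * ((1 + \<xi>\<^sup>2) powr s * (cmod (g \<xi>))\<^sup>2) + 2 * b\<^sup>2 * ((1 + \<xi>\<^sup>2) powr s * (cmod (k \<xi>))\<^sup>2))"
      by (intro AE_I2) (simp add: algebra_simps)
  qed auto
  with is_fourier_transform_lincomb[OF sq g(1) k(1), of a b] square_integrable_lincomb[OF sq, of a b]
  show ?thesis unfolding sobolev_def by auto
qed

lemma sobolev_antimono:
  assumes "r \<le> s"
  shows "sobolev s \<subseteq> sobolev r"
proof
  fix f assume "f \<in> sobolev s"
  then obtain g where g: "square_integrable f" "is_fourier_transform f g"
    "integrable lborel (\<lambda>\<xi>. (1 + \<xi>\<^sup>2) powr s * (cmod (g \<xi>))\<^sup>2)"
    by (auto simp: sobolev_def)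
  have [measurable]: "g \<in> borel_measurable lborel"
    using g by (auto simp: square_integrable_def is_fourier_transform_def)
  have "integrable lborel (\<lambda>\<xi>. (1 + \<xi>\<^sup>2) powr r * (cmod (g \<xi>))\<^sup>2)"
    by (rule Bochner_Integration.integrable_bound[OF g(3)])
      (use assms in \<open>auto intro!: AE_I2 mult_right_mono powr_mono\<close>)
  with g show "f \<in> sobolev r" by (auto simp: sobolev_def)
qed

text \<open>
  Cauchy--Schwarz for the factors \<open>(1 + \<xi>\<^sup>2) powr ((r - s) / 2)\<close> and \<open>(1 + \<xi>\<^sup>2) powr (s / 2) * \<bar>g\<bar>\<close>.
  The case \<open>r = 0\<close> controls the values of a function, the case \<open>r = 1\<close> its derivative.
\<close>
lemma fourier_moment_bound:
  assumes g: "square_integrable g" and i: "integrable lborel (\<lambda>\<xi>. (1 + \<xi>\<^sup>2) powr s * (cmod (g \<xi>))\<^sup>2)"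
    and s: "s > r + 1 / 2"
  shows "integrable lborel (\<lambda>\<xi>. (1 + \<xi>\<^sup>2) powr (r / 2) * cmod (g \<xi>))"
    and "(LINT \<xi>|lborel. (1 + \<xi>\<^sup>2) powr (r / 2) * cmod (g \<xi>))
      \<le> sqrt (LINT \<xi>|lborel. (1 + \<xi>\<^sup>2) powr (r - s)) * sqrt (LINT \<xi>|lborel. (1 + \<xi>\<^sup>2) powr s * (cmod (g \<xi>))\<^sup>2)"
proof -
  have [measurable]: "g \<in> borel_measurable lborel" using g by (auto simp: square_integrable_def)
  define a where "a \<xi> = (1 + \<xi>\<^sup>2) powr ((r - s) / 2)" for \<xi> :: real
  define b where "b \<xi> = (1 + \<xi>\<^sup>2) powr (s / 2) * cmod (g \<xi>)" for \<xi>
  have a2: "(a \<xi>)\<^sup>2 = (1 + \<xi>\<^sup>2) powr (r - s)" and b2: "(b \<xi>)\<^sup>2 = (1 + \<xi>\<^sup>2) powr s * (cmod (g \<xi>))\<^sup>2" for \<xi>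
    by (simp_all add: a_def b_def power_mult_distrib power2_eq_square[of "_ powr _"] flip: powr_add)
  have ab: "\<bar>a \<xi>\<bar> * \<bar>b \<xi>\<bar> = (1 + \<xi>\<^sup>2) powr (r / 2) * cmod (g \<xi>)" for \<xi>
    by (simp add: a_def b_def abs_mult diff_divide_distrib flip: mult.assoc powr_add)
  have sa: "square_integrable a"
    using integrable_japanese_bracket[of "s - r"] s by (simp add: square_integrable_def a2) (simp add: a_def[abs_def])
  have sb: "square_integrable b"
    using i by (simp add: square_integrable_def b2) (simp add: b_def[abs_def])
  show "integrable lborel (\<lambda>\<xi>. (1 + \<xi>\<^sup>2) powr (r / 2) * cmod (g \<xi>))"
    using integrable_mult_square_integrable[OF sa sb, THEN integrable_abs] by (simp add: abs_mult ab)
  show "(LINT \<xi>|lborel. (1 + \<xi>\<^sup>2) powr (r / 2) * cmod (g \<xi>))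
      \<le> sqrt (LINT \<xi>|lborel. (1 + \<xi>\<^sup>2) powr (r - s)) * sqrt (LINT \<xi>|lborel. (1 + \<xi>\<^sup>2) powr s * (cmod (g \<xi>))\<^sup>2)"
    using Cauchy_Schwarz_integral[OF sa sb] by (simp add: ab a2 b2)
qed

lemma fourier_inversion_real:
  assumes f: "square_integrable f" and c: "continuous_on UNIV f"
    and g: "is_fourier_transform f g" and ig: "integrable lborel g"
  shows "sqrt (2 * pi) * f x = (LINT \<xi>|lborel. Re (g \<xi> * cis (x * \<xi>)))"
proof -
  have [measurable]: "g \<in> borel_measurable lborel" using ig by auto
  have "integrable lborel (\<lambda>\<xi>. g \<xi> * cis (x * \<xi>))"
    by (rule Bochner_Integration.integrable_bound[OF ig]) (auto simp: norm_mult)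
  then show ?thesis
    using arg_cong[OF fourier_inversion[OF assms, of x], of Re] by (simp flip: integral_Re)
qed

lemma sobolev_sup_bound:
  assumes s: "s > 1 / 2"
  obtains C where "C \<ge> 0" "\<And>f x. f \<in> sobolev s \<Longrightarrow> continuous_on UNIV f \<Longrightarrow> \<bar>f x\<bar> \<le> C * sobolev_norm s f"
proof
  define C where "C = sqrt (LINT \<xi>|lborel. (1 + \<xi>\<^sup>2) powr (- s)) / sqrt (2 * pi)"
  show "C \<ge> 0" by (auto simp: C_def)
  fix f x assume f: "f \<in> sobolev s" and c: "continuous_on UNIV f"
  obtain g where g: "is_fourier_transform f g"
    "integrable lborel (\<lambda>\<xi>. (1 + \<xi>\<^sup>2) powr s * (cmod (g \<xi>))\<^sup>2)"
    "sobolev_norm s f = sqrt (LINT \<xi>|lborel. (1 + \<xi>\<^sup>2) powr s * (cmod (g \<xi>))\<^sup>2)"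
    by (rule sobolev_norm_realizer[OF f])
  have sf: "square_integrable f" and sg: "square_integrable g"
    using f g by (auto simp: sobolev_def is_fourier_transform_def)
  have [measurable]: "g \<in> borel_measurable lborel" using sg by (auto simp: square_integrable_def)
  have nz: "1 + \<xi>\<^sup>2 \<noteq> 0" for \<xi> :: real using add_pos_nonneg[of 1 "\<xi>\<^sup>2"] by simp
  have s': "s > 0 + 1 / 2" using s by simp
  have ing: "integrable lborel (\<lambda>\<xi>. cmod (g \<xi>))"
    and le: "(LINT \<xi>|lborel. cmod (g \<xi>)) \<le> sqrt (LINT \<xi>|lborel. (1 + \<xi>\<^sup>2) powr (- s)) * sobolev_norm s f"
    using fourier_moment_bound[OF sg g(2) s'] by (simp_all add: nz g(3))
  have ig: "integrable lborel g" using ing by (simp add: integrable_norm_iff)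
  have "sqrt (2 * pi) * \<bar>f x\<bar> = \<bar>LINT \<xi>|lborel. Re (g \<xi> * cis (x * \<xi>))\<bar>"
    unfolding fourier_inversion_real[OF sf c g(1) ig, of x, symmetric] by (simp add: abs_mult)
  also have "\<dots> \<le> (LINT \<xi>|lborel. cmod (g \<xi>))"
  proof (rule integral_abs_bound[THEN order_trans], rule integral_mono)
    show Re_le: "\<bar>Re (g \<xi> * cis (x * \<xi>))\<bar> \<le> cmod (g \<xi>)" for \<xi>
      using abs_Re_le_cmod[of "g \<xi> * cis (x * \<xi>)"] by (simp add: norm_mult del: times_complex.sel)
    show "integrable lborel (\<lambda>\<xi>. \<bar>Re (g \<xi> * cis (x * \<xi>))\<bar>)"
      by (rule Bochner_Integration.integrable_bound[OF ing])
        (use Re_le in \<open>simp_all del: times_complex.sel\<close>)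
  qed (rule ing)
  also note le
  finally show "\<bar>f x\<bar> \<le> C * sobolev_norm s f" by (simp add: C_def field_simps)
qed

text \<open>
  For \<open>s > 3/2\<close> the function \<open>\<xi> * g \<xi>\<close> is integrable, so the inversion formula can be differentiated
  under the integral sign.
\<close>
lemma sobolev_deriv_bound:
  assumes s: "s > 3 / 2"
  obtains C where "C \<ge> 0"
    "\<And>f x. f \<in> sobolev s \<Longrightarrow> continuous_on UNIV f \<Longrightarrow> (f has_real_derivative deriv f x) (at x)"
    "\<And>f. f \<in> sobolev s \<Longrightarrow> continuous_on UNIV f \<Longrightarrow> continuous_on UNIV (deriv f)"
    "\<And>f x. f \<in> sobolev s \<Longrightarrow> continuous_on UNIV f \<Longrightarrow> \<bar>deriv f x\<bar> \<le> C * sobolev_norm s f"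
proof
  define C where "C = sqrt (LINT \<xi>|lborel. (1 + \<xi>\<^sup>2) powr (1 - s)) / sqrt (2 * pi)"
  show "C \<ge> 0" by (auto simp: C_def)
  fix f assume f: "f \<in> sobolev s" and c: "continuous_on UNIV f"
  obtain g where g: "is_fourier_transform f g"
    "integrable lborel (\<lambda>\<xi>. (1 + \<xi>\<^sup>2) powr s * (cmod (g \<xi>))\<^sup>2)"
    "sobolev_norm s f = sqrt (LINT \<xi>|lborel. (1 + \<xi>\<^sup>2) powr s * (cmod (g \<xi>))\<^sup>2)"
    by (rule sobolev_norm_realizer[OF f])
  have sf: "square_integrable f" and sg: "square_integrable g"
    using f g by (auto simp: sobolev_def is_fourier_transform_def)
  have [measurable]: "g \<in> borel_measurable lborel" using sg by (auto simp: square_integrable_def)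
  have s': "s > 1 + 1 / 2" using s by simp
  define w where "w \<xi> = (1 + \<xi>\<^sup>2) powr (1 / 2) * cmod (g \<xi>)" for \<xi>
  have iw: "integrable lborel w"
    and le: "(LINT \<xi>|lborel. w \<xi>) \<le> sqrt (LINT \<xi>|lborel. (1 + \<xi>\<^sup>2) powr (1 - s)) * sobolev_norm s f"
    using fourier_moment_bound[OF sg g(2) s'] by (simp_all add: g(3) w_def[abs_def])
  have b1: "1 \<le> (1 + \<xi>\<^sup>2) powr (1 / 2)" and b2: "\<bar>\<xi>\<bar> \<le> (1 + \<xi>\<^sup>2) powr (1 / 2)" for \<xi> :: real
    by (auto simp: powr_half_sqrt intro!: real_le_rsqrt)
  have gw: "cmod (g \<xi>) \<le> w \<xi>" and gw': "\<bar>\<xi>\<bar> * cmod (g \<xi>) \<le> w \<xi>" for \<xi>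
    using mult_right_mono[OF b1, of "cmod (g \<xi>)" \<xi>] mult_right_mono[OF b2, of "cmod (g \<xi>)" \<xi>] by (auto simp: w_def)
  have ig: "integrable lborel g"
    by (rule Bochner_Integration.integrable_bound[OF iw]) (auto intro!: AE_I2 order_trans[OF gw])
  define \<phi> where "\<phi> \<xi> y = Re (g \<xi>) * cos (y * \<xi>) - Im (g \<xi>) * sin (y * \<xi>)" for \<xi> y
  define \<phi>' where "\<phi>' \<xi> y = \<xi> * (- Re (g \<xi>) * sin (y * \<xi>) - Im (g \<xi>) * cos (y * \<xi>))" for \<xi> y
  have \<phi>'_Re: "\<phi>' \<xi> y = Re (\<xi> *\<^sub>R (\<i> * (g \<xi> * cis (y * \<xi>))))" for \<xi> y
    by (simp add: \<phi>'_def algebra_simps)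
  have inv: "sqrt (2 * pi) * f y = (LINT \<xi>|lborel. \<phi> \<xi> y)" for y
    using fourier_inversion_real[OF sf c g(1) ig, of y] by (simp add: \<phi>_def)
  have bd: "\<bar>\<phi>' \<xi> y\<bar> \<le> w \<xi>" for \<xi> y
    unfolding \<phi>'_Re by (rule abs_Re_le_cmod[THEN order_trans]) (use gw' in \<open>simp add: norm_mult\<close>)
  have D: "((\<lambda>y. LINT \<xi>|lborel. \<phi> \<xi> y) has_real_derivative (LINT \<xi>|lborel. \<phi>' \<xi> y)) (at y)" for y
  proof (rule has_real_derivative_integral_dominated[OF _ bd iw])
    show "(\<phi> \<xi> has_real_derivative \<phi>' \<xi> y) (at y)" for \<xi> y
      unfolding \<phi>_def[abs_def] \<phi>'_def by (auto intro!: derivative_eq_intros simp: algebra_simps)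
    show "integrable lborel (\<lambda>\<xi>. \<phi> \<xi> y)" for y
    proof (rule Bochner_Integration.integrable_bound[OF iw])
      have Re_le: "\<bar>Re (g \<xi> * cis (y * \<xi>))\<bar> \<le> w \<xi>" for \<xi>
        by (rule abs_Re_le_cmod[THEN order_trans]) (use gw in \<open>simp add: norm_mult\<close>)
      then have "\<bar>\<phi> \<xi> y\<bar> \<le> \<bar>w \<xi>\<bar>" for \<xi> using order_trans[OF Re_le[of \<xi>] abs_ge_self] by (simp add: \<phi>_def)
      then show "AE \<xi> in lborel. norm (\<phi> \<xi> y) \<le> norm (w \<xi>)" by simp
    qed (auto simp: \<phi>_def)
  qed (auto simp: \<phi>'_def)
  have D': "(f has_real_derivative (LINT \<xi>|lborel. \<phi>' \<xi> y) / sqrt (2 * pi)) (at y)" for y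
    using DERIV_cdivide[OF D, of "sqrt (2 * pi)" y] unfolding inv[symmetric] by simp
  then have df: "deriv f = (\<lambda>y. (LINT \<xi>|lborel. \<phi>' \<xi> y) / sqrt (2 * pi))"
    by (auto intro: DERIV_imp_deriv)
  show "(f has_real_derivative deriv f x) (at x)" for x using D' df by simp
  show "continuous_on UNIV (deriv f)"
    unfolding df
    by (intro continuous_intros continuous_on_integral_dominated[OF _ bd iw])
      (auto simp: \<phi>'_def intro!: continuous_intros)
  show "\<bar>deriv f x\<bar> \<le> C * sobolev_norm s f" for x
  proof -
    have "\<bar>LINT \<xi>|lborel. \<phi>' \<xi> x\<bar> \<le> (LINT \<xi>|lborel. w \<xi>)"
    proof (rule integral_abs_bound[THEN order_trans], rule integral_mono[OF _ iw bd])
      show "integrable lborel (\<lambda>\<xi>. \<bar>\<phi>' \<xi> x\<bar>)"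
      proof (rule Bochner_Integration.integrable_bound[OF iw])
        have "\<bar>\<phi>' \<xi> x\<bar> \<le> \<bar>w \<xi>\<bar>" for \<xi> using bd[of \<xi> x] by simp
        then show "AE \<xi> in lborel. norm \<bar>\<phi>' \<xi> x\<bar> \<le> norm (w \<xi>)" by simp
      qed (simp add: \<phi>'_def[abs_def])
    qed
    with le show ?thesis by (simp add: df C_def field_simps)
  qed
qed

text \<open>
  Time derivatives are given only up to null sets; this allows replacing them by continuous
  representatives.
\<close>
lemma sobolev_cong_AE:
  assumes f: "f \<in> sobolev s" and h: "h \<in> borel_measurable lborel" and eq: "AE x in lborel. f x = h x"
  shows "h \<in> sobolev s" "sobolev_norm s h = sobolev_norm s f"
proof -
  have fm: "f \<in> borel_measurable lborel" and sf: "integrable lborel (\<lambda>x. (norm (f x))\<^sup>2)"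
    using f by (auto simp: sobolev_def square_integrable_def)
  have ft: "is_fourier_transform f = is_fourier_transform h"
    by (rule is_fourier_transform_cong_AE[OF fm h eq])
  have "integrable lborel (\<lambda>x. (norm (h x))\<^sup>2)"
    by (rule integrable_cong_AE_imp[OF sf]) (use h eq in auto)
  then show "h \<in> sobolev s" using f h by (auto simp: sobolev_def square_integrable_def ft)
  show "sobolev_norm s h = sobolev_norm s f" by (simp add: sobolev_norm_def ft)
qed

section \<open>Convolution with the derivative of the Green function\<close>

lemma has_bochner_integral_laplace_kernel:
  assumes a: "a > 0"
  shows "has_bochner_integral lborel (\<lambda>y::real. exp (- (a * \<bar>x - y\<bar>))) (2 / a)"
proof -
  define h where "h z = indicator {0..} z * exp (- (a * z))" for z :: real
  have F: "((\<lambda>z. - exp (- (a * z)) / a) has_real_derivative exp (- (a * z))) (at z)" for z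
    using a by (auto intro!: derivative_eq_intros)
  have lim: "((\<lambda>z. - exp (- (a * z)) / a) \<longlongrightarrow> 0) at_top"
    using a by real_asymp
  have "(\<integral>\<^sup>+z. ennreal (exp (- (a * z))) * indicator {0..} z \<partial>lborel) = ennreal (0 - - exp (- (a * 0)) / a)"
    by (rule nn_integral_FTC_atLeast[OF _ F _ lim]) auto
  then have "(\<integral>\<^sup>+z. ennreal (h z) \<partial>lborel) = ennreal (1 / a)"
    by (simp add: h_def ennreal_mult' ennreal_indicator mult_ac cong: nn_integral_cong)
  then have h: "has_bochner_integral lborel h (1 / a)"
    using a by (intro has_bochner_integral_nn_integral) (auto simp: h_def[abs_def])
  then have h': "has_bochner_integral lborel (\<lambda>z. h (0 + (-1) * z)) ((1 / a) /\<^sub>R \<bar>-1\<bar>)"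
    by (subst (asm) lborel_has_bochner_integral_real_affine_iff[of "-1" _ _ 0]) auto
  have "has_bochner_integral lborel (\<lambda>z. h z + h (0 + (-1) * z)) (1 / a + (1 / a) /\<^sub>R \<bar>-1\<bar>)"
    by (rule has_bochner_integral_add[OF h h'])
  moreover have "AE z in lborel. h z + h (0 + (-1) * z) = exp (- (a * \<bar>z\<bar>))"
    using AE_lborel_singleton[of 0] by eventually_elim (auto simp: h_def indicator_def)
  ultimately have "has_bochner_integral lborel (\<lambda>z. exp (- (a * \<bar>z\<bar>))) (1 / a + (1 / a) /\<^sub>R \<bar>-1\<bar>)"
    by (subst (asm) has_bochner_integral_cong_AE) (auto simp: h_def[abs_def])
  then have "has_bochner_integral lborel (\<lambda>z. exp (- (a * \<bar>z\<bar>))) (2 / a)" by simp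
  from this[unfolded lborel_has_bochner_integral_real_affine_iff[of "-1" "\<lambda>z. exp (- (a * \<bar>z\<bar>))" "2 / a" x, simplified]]
  show ?thesis by simp
qed

lemma deriv_G:
  assumes "z \<noteq> 0"
  shows "deriv G z = - sgn z * exp (- \<bar>z\<bar>) / 2"
proof (cases "z > 0")
  case True
  have "((\<lambda>z. exp (- z) / 2) has_real_derivative - exp (- z) / 2) (at z)"
    by (auto intro!: derivative_eq_intros)
  then have "(G has_real_derivative - exp (- z) / 2) (at z)"
    by (rule has_field_derivative_transform_within_open[where S="{0<..}"]) (use True in \<open>auto simp: G_def\<close>)
  then show ?thesis using True by (simp add: DERIV_imp_deriv)
next
  case False
  with assms have z: "z < 0" by simp
  have "((\<lambda>z. exp z / 2) has_real_derivative exp z / 2) (at z)"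
    by (auto intro!: derivative_eq_intros)
  then have "(G has_real_derivative exp z / 2) (at z)"
    by (rule has_field_derivative_transform_within_open[where S="{..<0}"]) (use z in \<open>auto simp: G_def\<close>)
  then show ?thesis using z by (simp add: DERIV_imp_deriv)
qed

lemma measurable_deriv_G [measurable]: "deriv G \<in> borel_measurable borel"
proof -
  have "deriv G = (\<lambda>z. if z = 0 then deriv G 0 else - sgn z * exp (- \<bar>z\<bar>) / 2)"
    by (auto simp: deriv_G)
  also have "\<dots> \<in> borel_measurable borel" by measurable
  finally show ?thesis .
qed

lemma abs_deriv_G: "z \<noteq> 0 \<Longrightarrow> \<bar>deriv G z\<bar> = exp (- \<bar>z\<bar>) / 2"
  by (simp add: deriv_G abs_mult abs_sgn_eq)

text \<open>
  The kernel is Lipschitz on each side of its jump at the origin. The indicator function accounts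
  for the arguments between which the jump lies.
\<close>
lemma deriv_G_diff:
  assumes h: "0 < h" "h \<le> 1" and z: "z \<noteq> 0" "z + h \<noteq> 0"
  shows "\<bar>deriv G (z + h) - deriv G z\<bar> \<le> h * exp 1 / 2 * exp (- \<bar>z\<bar>) + indicator {-h..0} z"
proof -
  consider "z > 0" | "z + h < 0" | "z < 0" "z + h > 0" using z by linarith
  then show ?thesis
  proof cases
    case 1
    have "1 - exp (- h) \<le> h" "0 \<le> 1 - exp (- h)" using exp_ge_add_one_self[of "- h"] h by auto
    moreover have "h * 1 \<le> h * exp 1" using h by (intro mult_left_mono) auto
    ultimately have "exp (- z) * (1 - exp (- h)) \<le> exp (- z) * (h * exp 1)"
      by (intro mult_left_mono) auto
    moreover have "\<bar>deriv G (z + h) - deriv G z\<bar> = exp (- z) * (1 - exp (- h)) / 2"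
      using 1 h by (simp add: deriv_G exp_add exp_diff exp_minus field_simps)
    ultimately show ?thesis using 1 by (simp add: mult_ac indicator_def)
  next
    case 2
    have "exp (- h) \<ge> 1 - h" using exp_ge_add_one_self[of "- h"] by simp
    then have "exp h * (1 - h) \<le> exp h * exp (- h)" by (intro mult_left_mono) auto
    then have "exp h - 1 \<le> h * exp h" by (simp add: algebra_simps flip: exp_add)
    also have "h * exp h \<le> h * exp 1" using h by (intro mult_left_mono) auto
    finally have "exp z * (exp h - 1) \<le> exp z * (h * exp 1)" by (intro mult_left_mono) auto
    moreover have "\<bar>deriv G (z + h) - deriv G z\<bar> = exp z * (exp h - 1) / 2"
      using 2 h by (simp add: deriv_G exp_add field_simps)
    ultimately show ?thesis using 2 h by (simp add: mult_ac indicator_def)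
  next
    case 3
    have "\<bar>deriv G (z + h) - deriv G z\<bar> \<le> \<bar>deriv G (z + h)\<bar> + \<bar>deriv G z\<bar>" by linarith
    also have "\<dots> \<le> 1 / 2 + 1 / 2" using 3 by (intro add_mono) (auto simp: abs_deriv_G)
    also have "\<dots> \<le> h * exp 1 / 2 * exp (- \<bar>z\<bar>) + indicator {-h..0} z" using 3 h by (simp add: indicator_def)
    finally show ?thesis .
  qed
qed

text \<open>
  Throughout, \<open>b\<close> is a weight whose logarithm has Lipschitz constant \<open>\<theta> < 1\<close>, so that
  convolution with \<open>exp (- \<bar>x\<bar>)\<close> preserves the bound \<open>S * b\<close> up to a constant.
\<close>
context
  fixes F b :: "real \<Rightarrow> real" and S \<theta> :: real
  assumes F [measurable]: "F \<in> borel_measurable borel"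
    and FS: "\<And>y. \<bar>F y\<bar> \<le> S * b y" and S: "0 \<le> S"
    and \<theta>: "0 \<le> \<theta>" "\<theta> < 1"
    and b: "\<And>x y. b y \<le> b x * exp (\<theta> * \<bar>x - y\<bar>)" and b0: "\<And>x. 0 < b x"
begin

lemma weighted_bound_shift: "\<bar>F y\<bar> \<le> S * b x * exp (\<theta> * \<bar>x - y\<bar>)"
  using FS[of y] mult_left_mono[OF b[of y x] S] by (simp add: mult_ac)

lemma deriv_G_mult_bound:
  assumes "y \<noteq> x"
  shows "\<bar>deriv G (x - y) * F y\<bar> \<le> S * b x / 2 * exp (- ((1 - \<theta>) * \<bar>x - y\<bar>))"
proof -
  have "\<bar>deriv G (x - y) * F y\<bar> = exp (- \<bar>x - y\<bar>) / 2 * \<bar>F y\<bar>"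
    using assms by (simp add: abs_mult abs_deriv_G)
  also have "\<dots> \<le> exp (- \<bar>x - y\<bar>) / 2 * (S * b x * exp (\<theta> * \<bar>x - y\<bar>))"
    by (intro mult_left_mono weighted_bound_shift) auto
  also have "\<dots> = S * b x / 2 * (exp (- \<bar>x - y\<bar>) * exp (\<theta> * \<bar>x - y\<bar>))" by simp
  also have "exp (- \<bar>x - y\<bar>) * exp (\<theta> * \<bar>x - y\<bar>) = exp (- ((1 - \<theta>) * \<bar>x - y\<bar>))"
    by (simp add: algebra_simps flip: exp_add)
  finally show ?thesis .
qed

lemma integrable_deriv_G_mult: "integrable lborel (\<lambda>y. deriv G (x - y) * F y)"
proof (rule Bochner_Integration.integrable_bound)
  show "integrable lborel (\<lambda>y. S * b x / 2 * exp (- ((1 - \<theta>) * \<bar>x - y\<bar>)))"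
    using has_bochner_integral_laplace_kernel[of "1 - \<theta>" x] \<theta> by (auto simp: has_bochner_integral_iff)
  show "AE y in lborel. norm (deriv G (x - y) * F y) \<le> norm (S * b x / 2 * exp (- ((1 - \<theta>) * \<bar>x - y\<bar>)))"
    using AE_lborel_singleton[of x]
    by eventually_elim (use deriv_G_mult_bound S b0[of x] in \<open>auto simp: abs_mult\<close>)
qed measurable

lemma convolution_deriv_G_bound: "\<bar>Defs.convolution (deriv G) F x\<bar> \<le> S * b x / (1 - \<theta>)"
proof -
  have k: "has_bochner_integral lborel (\<lambda>y. exp (- ((1 - \<theta>) * \<bar>x - y\<bar>))) (2 / (1 - \<theta>))"
    using has_bochner_integral_laplace_kernel[of "1 - \<theta>" x] \<theta> by simp
  have "\<bar>Defs.convolution (deriv G) F x\<bar> \<le> (LINT y|lborel. \<bar>deriv G (x - y) * F y\<bar>)"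
    unfolding Defs.convolution_def by (rule integral_abs_bound)
  also have "\<dots> \<le> (LINT y|lborel. S * b x / 2 * exp (- ((1 - \<theta>) * \<bar>x - y\<bar>)))"
  proof (rule integral_mono_AE)
    show "AE y in lborel. \<bar>deriv G (x - y) * F y\<bar> \<le> S * b x / 2 * exp (- ((1 - \<theta>) * \<bar>x - y\<bar>))"
      using AE_lborel_singleton[of x] by eventually_elim (use deriv_G_mult_bound in auto)
  qed (use k integrable_deriv_G_mult in \<open>auto simp: has_bochner_integral_iff\<close>)
  also have "\<dots> = S * b x / 2 * (2 / (1 - \<theta>))"
    by (simp only: integral_mult_right_zero has_bochner_integral_integral_eq[OF k])
  also have "\<dots> = S * b x / (1 - \<theta>)" using \<theta> by (simp add: field_simps)
  finally show ?thesis .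
qed

lemma convolution_deriv_G_diff:
  assumes h: "0 < h" "h \<le> 1"
  shows "\<bar>Defs.convolution (deriv G) F (x + h) - Defs.convolution (deriv G) F x\<bar> \<le> h * (S * b x * (exp 1 / (1 - \<theta>) + exp 1))"
proof -
  have k: "has_bochner_integral lborel (\<lambda>y. exp (- ((1 - \<theta>) * \<bar>x - y\<bar>))) (2 / (1 - \<theta>))"
    using has_bochner_integral_laplace_kernel[of "1 - \<theta>" x] \<theta> by simp
  have i: "has_bochner_integral lborel (indicator {x..x+h}) h"
    using has_bochner_integral_real_indicator[of "{x..x+h}" lborel] h by (simp add: emeasure_lborel_Icc_eq)
  let ?B = "\<lambda>y. S * b x * (h * exp 1 / 2) * exp (- ((1 - \<theta>) * \<bar>x - y\<bar>)) + S * b x * exp 1 * indicator {x..x+h} y"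
  have B: "has_bochner_integral lborel ?B (S * b x * (h * exp 1 / 2) * (2 / (1 - \<theta>)) + S * b x * exp 1 * h)"
    by (intro has_bochner_integral_add has_bochner_integral_mult_right k i)
  have pt: "\<bar>deriv G (x + h - y) * F y - deriv G (x - y) * F y\<bar> \<le> ?B y" if y: "y \<noteq> x" "y \<noteq> x + h" for y
  proof -
    have i: "indicator {-h..0} (x - y) = (indicator {x..x+h} y :: real)" by (auto simp: indicator_def)
    have Sb: "0 \<le> S * b x" using S b0[of x] by simp
    have ek: "exp (- \<bar>x - y\<bar>) * exp (\<theta> * \<bar>x - y\<bar>) = exp (- ((1 - \<theta>) * \<bar>x - y\<bar>))"
      by (simp add: algebra_simps flip: exp_add)
    have "\<theta> * \<bar>x - y\<bar> \<le> 1" if "y \<in> {x..x+h}"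
    proof -
      have "\<theta> * \<bar>x - y\<bar> \<le> 1 * 1" using that h \<theta> by (intro mult_mono) auto
      then show ?thesis by simp
    qed
    then have i2: "indicator {x..x+h} y * exp (\<theta> * \<bar>x - y\<bar>) \<le> exp 1 * indicator {x..x+h} y"
      by (auto simp: indicator_def)
    have "\<bar>deriv G (x + h - y) * F y - deriv G (x - y) * F y\<bar> = \<bar>deriv G ((x - y) + h) - deriv G (x - y)\<bar> * \<bar>F y\<bar>"
      by (simp add: algebra_simps flip: abs_mult)
    also have "\<dots> \<le> (h * exp 1 / 2 * exp (- \<bar>x - y\<bar>) + indicator {-h..0} (x - y)) * (S * b x * exp (\<theta> * \<bar>x - y\<bar>))"
      using y h by (intro mult_mono deriv_G_diff weighted_bound_shift) auto
    also have "\<dots> = S * b x * (h * exp 1 / 2) * (exp (- \<bar>x - y\<bar>) * exp (\<theta> * \<bar>x - y\<bar>)) + S * b x * (indicator {x..x+h} y * exp (\<theta> * \<bar>x - y\<bar>))"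
      unfolding i by (simp add: algebra_simps)
    also have "\<dots> \<le> S * b x * (h * exp 1 / 2) * exp (- ((1 - \<theta>) * \<bar>x - y\<bar>)) + S * b x * (exp 1 * indicator {x..x+h} y)"
      unfolding ek by (intro add_left_mono mult_left_mono[OF i2] Sb)
    finally show ?thesis by (simp add: mult_ac)
  qed
  have "\<bar>Defs.convolution (deriv G) F (x + h) - Defs.convolution (deriv G) F x\<bar>
      = \<bar>LINT y|lborel. deriv G (x + h - y) * F y - deriv G (x - y) * F y\<bar>"
    using integrable_deriv_G_mult[of "x + h"] integrable_deriv_G_mult[of x] by (simp add: Defs.convolution_def)
  also have "\<dots> \<le> (LINT y|lborel. \<bar>deriv G (x + h - y) * F y - deriv G (x - y) * F y\<bar>)"
    by (rule integral_abs_bound)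
  also have "\<dots> \<le> (LINT y|lborel. ?B y)"
  proof (rule integral_mono_AE)
    show "AE y in lborel. \<bar>deriv G (x + h - y) * F y - deriv G (x - y) * F y\<bar> \<le> ?B y"
      using AE_lborel_singleton[of x] AE_lborel_singleton[of "x + h"] by eventually_elim (rule pt)
    show "integrable lborel ?B" using B by (simp add: has_bochner_integral_iff)
  qed (intro integrable_abs Bochner_Integration.integrable_diff integrable_deriv_G_mult)
  also have "\<dots> = S * b x * (h * exp 1 / 2) * (2 / (1 - \<theta>)) + S * b x * exp 1 * h"
    using B by (rule has_bochner_integral_integral_eq)
  also have "\<dots> = h * (S * b x * (exp 1 / (1 - \<theta>) + exp 1))"
    using \<theta> by (simp add: field_simps)
  finally show ?thesis .
qed

end

text \<open>
  The difference estimate with \<open>b = 1\<close> and \<open>\<theta> = 0\<close> is a local Lipschitz bound.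
\<close>
lemma continuous_convolution_deriv_G:
  assumes [measurable]: "F \<in> borel_measurable borel" and S: "\<And>y. \<bar>F y\<bar> \<le> S"
  shows "continuous_on UNIV (Defs.convolution (deriv G) F)"
proof -
  have S0: "0 \<le> S" using S[of 0] by linarith
  define c where "c = S * (exp 1 + exp 1)"
  have c0: "0 \<le> c" using S0 by (simp add: c_def)
  have d: "\<bar>Defs.convolution (deriv G) F (x + h) - Defs.convolution (deriv G) F x\<bar> \<le> h * c" if "0 < h" "h \<le> 1" for x h
    using convolution_deriv_G_diff[of F S "\<lambda>_. 1" 0 h x] S S0 that by (simp add: c_def)
  have d': "\<bar>Defs.convolution (deriv G) F y - Defs.convolution (deriv G) F x\<bar> \<le> \<bar>y - x\<bar> * c" if "\<bar>y - x\<bar> \<le> 1" for x y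
    using d[of "y - x" x] d[of "x - y" y] that by (cases x y rule: linorder_cases) (auto simp: abs_minus_commute)
  show ?thesis
    unfolding continuous_on_eq_continuous_at[OF open_UNIV]
  proof
    fix x
    have "((\<lambda>y. \<bar>y - x\<bar> * c) \<longlongrightarrow> \<bar>x - x\<bar> * c) (at x)" by (intro tendsto_intros)
    then have lim: "((\<lambda>y. \<bar>y - x\<bar> * c) \<longlongrightarrow> 0) (at x)" by simp
    have "\<forall>\<^sub>F y in at x. \<bar>y - x\<bar> \<le> 1"
      unfolding eventually_at by (auto intro!: exI[of _ 1] simp: dist_real_def)
    then have "\<forall>\<^sub>F y in at x. norm (Defs.convolution (deriv G) F y - Defs.convolution (deriv G) F x) \<le> \<bar>y - x\<bar> * c"
      by eventually_elim (use d' in auto)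
    from Lim_null_comparison[OF this lim] show "isCont (Defs.convolution (deriv G) F) x"
      by (simp add: isCont_def LIM_zero_iff)
  qed
qed

section \<open>A weighted maximum principle for transport equations\<close>

lemma derivative_at_left_maximum_nonneg:
  fixes f :: "real \<Rightarrow> real"
  assumes d: "(f has_real_derivative D) (at t within {a..c})" and t: "a < t" "t \<le> c"
    and max: "\<And>r. a \<le> r \<Longrightarrow> r \<le> t \<Longrightarrow> f r \<le> f t"
  shows "0 \<le> D"
proof -
  have "((\<lambda>r. (f r - f t) / (r - t)) \<longlongrightarrow> D) (at t within {a..<t})"
    using d[unfolded has_field_derivative_iff] by (rule tendsto_within_subset) (use t in auto)
  moreover have "\<forall>\<^sub>F r in at t within {a..<t}. 0 \<le> (f r - f t) / (r - t)"
    unfolding eventually_at by (auto intro!: exI[of _ 1] divide_nonpos_neg simp: max)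
  moreover have "at t within {a..<t} \<noteq> bot"
    using t by (simp add: trivial_limit_within islimpt_Ico)
  ultimately show ?thesis by (rule tendsto_lowerbound)
qed

text \<open>
  At a positive maximum of \<open>W = exp (- L * t) * w / b\<close> attained at a time \<open>t > 0\<close>, the space derivative
  of \<open>W\<close> vanishes and its time derivative is nonnegative. Inserting \<open>w\<close> in the differential
  inequality then bounds the maximum by \<open>S / (L - K1 - K * \<theta>)\<close>; the term \<open>K * \<theta>\<close> is the effect of
  transporting the weight. The growth of \<open>b\<close> at both ends ensures that a maximum exists.
\<close>
lemma transport_maximum_principle_upper:
  fixes w wt wx u :: "real \<Rightarrow> real \<Rightarrow> real" and b b' :: "real \<Rightarrow> real"
  assumes cont: "continuous_on ({0..T} \<times> UNIV) (\<lambda>(t, x). w t x)"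
    and bdd: "\<And>t x. t \<in> {0..T} \<Longrightarrow> \<bar>w t x\<bar> \<le> M"
    and wt: "\<And>t x. t \<in> {0..T} \<Longrightarrow> ((\<lambda>t. w t x) has_real_derivative wt t x) (at t within {0..T})"
    and wx: "\<And>t x. t \<in> {0..T} \<Longrightarrow> (w t has_real_derivative wx t x) (at x)"
    and b: "\<And>x. 0 < b x" "\<And>x. (b has_real_derivative b' x) (at x)" "\<And>x. \<bar>b' x\<bar> \<le> \<theta> * b x"
    and b_inf: "filterlim b at_top at_top" "filterlim b at_top at_bot"
    and u: "\<And>t x. t \<in> {0..T} \<Longrightarrow> \<bar>u t x\<bar> \<le> K"
    and eq: "\<And>t x. t \<in> {0..T} \<Longrightarrow> wt t x + u t x * wx t x \<le> S * exp (L * t) * b x + K1 * \<bar>w t x\<bar>"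
    and init: "\<And>x. w 0 x \<le> A * b x"
    and A: "0 \<le> A" and L: "0 \<le> L" "K1 + K * \<theta> < L"
    and t1: "t1 \<in> {0..T}"
  shows "w t1 x1 \<le> exp (L * t1) * b x1 * max A (S / (L - K1 - K * \<theta>))"
proof (rule ccontr)
  define m where "m = max A (S / (L - K1 - K * \<theta>))"
  define W where "W t x = exp (- (L * t)) * w t x / b x" for t x
  assume "\<not> ?thesis"
  then have "exp (L * t1) * b x1 * m < w t1 x1" by (simp add: m_def)
  then have W1: "m < W t1 x1"
    using b(1)[of x1] by (simp add: W_def exp_minus field_simps)
  have m0: "0 \<le> m" using A by (simp add: m_def)
  with W1 have W1pos: "0 < W t1 x1" by simp
  have contb: "continuous_on UNIV b"
    by (auto simp: continuous_on_eq_continuous_at intro!: DERIV_isCont b(2))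
  have contW: "continuous_on ({0..T} \<times> UNIV) (\<lambda>(t, x). W t x)"
    using cont contb b(1) unfolding W_def split_beta
    by (intro continuous_intros continuous_on_compose2[OF contb]) (auto simp: less_imp_neq[symmetric])
  have small: "W t x < W t1 x1" if "t \<in> {0..T}" "M / W t1 x1 < b x" for t x
  proof -
    have "W t x \<le> M / b x"
    proof -
      have "exp (- (L * t)) * w t x \<le> 1 * M"
        using bdd[OF that(1), of x] that(1) L
        by (intro order_trans[OF mult_left_mono[of "w t x" M]] mult_right_mono) auto
      then show ?thesis using b(1)[of x] by (simp add: W_def divide_right_mono)
    qed
    also have "M / b x < W t1 x1" using that(2) W1pos b(1)[of x] by (simp add: field_simps)
    finally show ?thesis .
  qed
  from b_inf(1) obtain R1 where R1: "\<And>x. R1 \<le> x \<Longrightarrow> M / W t1 x1 < b x"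
    unfolding filterlim_at_top_dense eventually_at_top_linorder by blast
  from b_inf(2) obtain R2 where R2: "\<And>x. x \<le> R2 \<Longrightarrow> M / W t1 x1 < b x"
    unfolding filterlim_at_top_dense eventually_at_bot_linorder by blast
  have x1: "x1 \<in> {R2..R1}"
  proof (rule ccontr)
    assume "x1 \<notin> {R2..R1}"
    then have "M / W t1 x1 < b x1" using R1[of x1] R2[of x1] by (cases "R2 \<le> x1") auto
    from small[OF t1 this] show False by simp
  qed
  have "compact ({0..T} \<times> {R2..R1})" by (intro compact_Times) auto
  moreover have "{0..T} \<times> {R2..R1} \<noteq> {}" using t1 x1 by auto
  moreover have "continuous_on ({0..T} \<times> {R2..R1}) (\<lambda>(t, x). W t x)"
    by (rule continuous_on_subset[OF contW]) auto
  ultimately obtain p where p: "p \<in> {0..T} \<times> {R2..R1}"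
    "\<And>q. q \<in> {0..T} \<times> {R2..R1} \<Longrightarrow> (\<lambda>(t, x). W t x) q \<le> (\<lambda>(t, x). W t x) p"
    using continuous_attains_sup by (metis (no_types, lifting))
  obtain t0 x0 where p0: "p = (t0, x0)" by (cases p)
  have t0: "t0 \<in> {0..T}" using p p0 by auto
  have max1: "W t x \<le> W t0 x0" if "t \<in> {0..T}" "x \<in> {R2..R1}" for t x
    using p(2)[of "(t, x)"] that p0 by auto
  have W10: "W t1 x1 \<le> W t0 x0" using max1 t1 x1 by simp
  have max: "W t x \<le> W t0 x0" if "t \<in> {0..T}" for t x
  proof (cases "x \<in> {R2..R1}")
    case True then show ?thesis using max1 that by simp
  next
    case False
    then have "M / W t1 x1 < b x" using R1[of x] R2[of x] by (cases "R2 \<le> x") auto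
    from small[OF that this] W10 show ?thesis by simp
  qed
  have Wm: "m < W t0 x0" using W1 W10 by simp
  have "t0 \<noteq> 0"
  proof
    assume "t0 = 0"
    then have "W t0 x0 \<le> A" using init[of x0] b(1)[of x0] by (simp add: W_def field_simps)
    with Wm show False by (simp add: m_def)
  qed
  with t0 have t0pos: "0 < t0" "t0 \<le> T" by auto
  define \<mu> where "\<mu> = w t0 x0"
  have \<mu>W: "\<mu> = W t0 x0 * (exp (L * t0) * b x0)"
    using b(1)[of x0] by (simp add: \<mu>_def W_def exp_minus field_simps)
  have \<mu>pos: "0 < \<mu>" unfolding \<mu>W using Wm m0 b(1)[of x0] by simp
  have "((\<lambda>x. exp (- (L * t0)) * w t0 x / b x) has_real_derivative
      (exp (- (L * t0)) * wx t0 x0 * b x0 - exp (- (L * t0)) * w t0 x0 * b' x0) / (b x0 * b x0)) (at x0)"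
    by (rule DERIV_divide[OF DERIV_cmult[OF wx[OF t0]] b(2)]) (use b(1)[of x0] in simp)
  from DERIV_local_max[OF this, of 1] max[OF t0]
  have "exp (- (L * t0)) * wx t0 x0 * b x0 - exp (- (L * t0)) * w t0 x0 * b' x0 = 0"
    using b(1)[of x0] by (simp add: W_def)
  then have "exp (- (L * t0)) * (wx t0 x0 * b x0 - \<mu> * b' x0) = 0" by (simp add: \<mu>_def algebra_simps)
  then have wxb: "wx t0 x0 * b x0 = \<mu> * b' x0" by simp
  have "\<bar>wx t0 x0\<bar> * b x0 = \<bar>wx t0 x0 * b x0\<bar>" using b(1)[of x0] by (simp add: abs_mult)
  also have "\<dots> \<le> \<mu> * (\<theta> * b x0)" unfolding wxb using \<mu>pos b(3)[of x0] by (simp add: abs_mult)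
  finally have wx_le: "\<bar>wx t0 x0\<bar> \<le> \<theta> * \<mu>" using b(1)[of x0] by (simp add: mult_ac)
  have "((\<lambda>t. exp (- (L * t)) * w t x0 / b x0) has_real_derivative
      (exp (- (L * t0)) * (- L) * w t0 x0 + wt t0 x0 * exp (- (L * t0))) / b x0) (at t0 within {0..T})"
    by (intro DERIV_cdivide DERIV_mult wt t0) (auto intro!: derivative_eq_intros)
  from derivative_at_left_maximum_nonneg[OF this t0pos] max[of _ x0] t0
  have "0 \<le> (exp (- (L * t0)) * (- L) * w t0 x0 + wt t0 x0 * exp (- (L * t0))) / b x0"
    by (simp add: W_def)
  then have "0 \<le> exp (- (L * t0)) * (wt t0 x0 - L * \<mu>)"
    using b(1)[of x0] by (simp add: \<mu>_def algebra_simps zero_le_divide_iff)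
  then have wt_ge: "L * \<mu> \<le> wt t0 x0" by (simp add: zero_le_mult_iff)
  have K0: "0 \<le> K" using u[OF t0, of x0] by linarith
  have "\<bar>u t0 x0 * wx t0 x0\<bar> \<le> K * (\<theta> * \<mu>)"
    unfolding abs_mult using u[OF t0] wx_le K0 by (intro mult_mono) auto
  then have "L * \<mu> - K * \<theta> * \<mu> \<le> S * exp (L * t0) * b x0 + K1 * \<mu>"
    using eq[OF t0, of x0] wt_ge \<mu>pos by (simp add: \<mu>_def)
  then have "(L - K1 - K * \<theta>) * W t0 x0 * (exp (L * t0) * b x0) \<le> S * (exp (L * t0) * b x0)"
    unfolding \<mu>W by (simp add: algebra_simps)
  then have "(L - K1 - K * \<theta>) * W t0 x0 \<le> S" using b(1)[of x0] by simp
  then have "W t0 x0 \<le> S / (L - K1 - K * \<theta>)" using L by (simp add: field_simps)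
  with Wm show False by (simp add: m_def)
qed

lemma transport_maximum_principle:
  fixes w wt wx u :: "real \<Rightarrow> real \<Rightarrow> real" and b b' :: "real \<Rightarrow> real"
  assumes cont: "continuous_on ({0..T} \<times> UNIV) (\<lambda>(t, x). w t x)"
    and bdd: "\<And>t x. t \<in> {0..T} \<Longrightarrow> \<bar>w t x\<bar> \<le> M"
    and wt: "\<And>t x. t \<in> {0..T} \<Longrightarrow> ((\<lambda>t. w t x) has_real_derivative wt t x) (at t within {0..T})"
    and wx: "\<And>t x. t \<in> {0..T} \<Longrightarrow> (w t has_real_derivative wx t x) (at x)"
    and b: "\<And>x. 0 < b x" "\<And>x. (b has_real_derivative b' x) (at x)" "\<And>x. \<bar>b' x\<bar> \<le> \<theta> * b x"
    and b_inf: "filterlim b at_top at_top" "filterlim b at_top at_bot"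
    and u: "\<And>t x. t \<in> {0..T} \<Longrightarrow> \<bar>u t x\<bar> \<le> K"
    and eq: "\<And>t x. t \<in> {0..T} \<Longrightarrow> \<bar>wt t x + u t x * wx t x\<bar> \<le> S * exp (L * t) * b x + K1 * \<bar>w t x\<bar>"
    and init: "\<And>x. \<bar>w 0 x\<bar> \<le> A * b x"
    and A: "0 \<le> A" and L: "0 \<le> L" "K1 + K * \<theta> < L"
    and t: "t \<in> {0..T}"
  shows "\<bar>w t x\<bar> \<le> exp (L * t) * b x * max A (S / (L - K1 - K * \<theta>))"
proof -
  have "w t x \<le> exp (L * t) * b x * max A (S / (L - K1 - K * \<theta>))"
    by (rule transport_maximum_principle_upper[OF cont bdd wt wx b b_inf u _ _ A L t])
      (use eq init abs_le_D1 in blast)+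
  moreover have "- w t x \<le> exp (L * t) * b x * max A (S / (L - K1 - K * \<theta>))"
  proof (rule transport_maximum_principle_upper[where w="\<lambda>t x. - w t x" and wt="\<lambda>t x. - wt t x" and wx="\<lambda>t x. - wx t x" and M=M and u=u and b'=b' and T=T])
    show "continuous_on ({0..T} \<times> UNIV) (\<lambda>(t, x). - w t x)"
      using continuous_on_minus[OF cont] by (simp add: split_beta)
    show "- wt t x + u t x * - wx t x \<le> S * exp (L * t) * b x + K1 * \<bar>- w t x\<bar>" if "t \<in> {0..T}" for t x
      using eq[OF that, of x] by simp
    show "- w 0 x \<le> A * b x" for x using init[of x] by simp
    show "((\<lambda>t. - w t x) has_real_derivative - wt r x) (at r within {0..T})" if "r \<in> {0..T}" for r x
      by (rule DERIV_minus[OF wt[OF that]])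
    show "((\<lambda>x. - w r x) has_real_derivative - wx r x) (at x)" if "r \<in> {0..T}" for r x
      by (rule DERIV_minus[OF wx[OF that]])
  qed (use bdd b b_inf u A L t in auto)
  ultimately show ?thesis by simp
qed

section \<open>Decay of classical solutions\<close>

text \<open>
  The term \<open>\<epsilon> * exp (\<theta> * x)\<close> makes the weight blow up at \<open>+\<infinity>\<close> as well, at the same exponential rate,
  so the logarithmic derivative still stays within \<open>[-\<theta>, \<theta>]\<close>.
\<close>
lemma exp_two_sided_weight:
  fixes \<theta> \<epsilon> :: real
  assumes \<theta>: "0 < \<theta>" and \<epsilon>: "0 < \<epsilon>"
  defines "b \<equiv> \<lambda>x. exp (- \<theta> * x) + \<epsilon> * exp (\<theta> * x)"
  shows "0 < b x"
    and "(b has_real_derivative (\<epsilon> * \<theta> * exp (\<theta> * x) - \<theta> * exp (- \<theta> * x))) (at x)"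
    and "\<bar>\<epsilon> * \<theta> * exp (\<theta> * x) - \<theta> * exp (- \<theta> * x)\<bar> \<le> \<theta> * b x"
    and "filterlim b at_top at_top" and "filterlim b at_top at_bot"
    and "b y \<le> b x * exp (\<theta> * \<bar>x - y\<bar>)"
    and "min 1 \<epsilon> \<le> b x"
proof -
  show pos: "0 < b x" unfolding b_def using \<epsilon> by (intro add_pos_pos) auto
  show "(b has_real_derivative (\<epsilon> * \<theta> * exp (\<theta> * x) - \<theta> * exp (- \<theta> * x))) (at x)"
    unfolding b_def by (auto intro!: derivative_eq_intros)
  have "\<bar>\<epsilon> * exp (\<theta> * x) - exp (- \<theta> * x)\<bar> \<le> b x" using \<epsilon> by (simp add: b_def abs_le_iff)
  then have "\<bar>\<theta> * (\<epsilon> * exp (\<theta> * x) - exp (- \<theta> * x))\<bar> \<le> \<theta> * b x"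
    unfolding abs_mult using \<theta> by (simp add: mult_left_mono)
  then show "\<bar>\<epsilon> * \<theta> * exp (\<theta> * x) - \<theta> * exp (- \<theta> * x)\<bar> \<le> \<theta> * b x"
    by (simp add: right_diff_distrib mult_ac)
  show "filterlim b at_top at_top" unfolding b_def using \<theta> \<epsilon> by real_asymp
  show "filterlim b at_top at_bot" unfolding b_def using \<theta> \<epsilon> by real_asymp
  have "exp (- \<theta> * y) \<le> exp (- \<theta> * x) * exp (\<theta> * \<bar>x - y\<bar>)"
    "exp (\<theta> * y) \<le> exp (\<theta> * x) * exp (\<theta> * \<bar>x - y\<bar>)"
    using mult_left_mono[of "x - y" "\<bar>x - y\<bar>" \<theta>] mult_left_mono[of "y - x" "\<bar>x - y\<bar>" \<theta>] \<theta>
    by (auto simp: algebra_simps simp flip: exp_add)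
  from add_mono[OF this(1) mult_left_mono[OF this(2), of \<epsilon>]] \<epsilon>
  show "b y \<le> b x * exp (\<theta> * \<bar>x - y\<bar>)" by (simp add: b_def algebra_simps)
  show "min 1 \<epsilon> \<le> b x"
  proof (cases "x \<le> 0")
    case True
    then have "1 \<le> exp (- \<theta> * x)" using \<theta> by (simp add: mult_nonneg_nonpos)
    moreover have "0 < \<epsilon> * exp (\<theta> * x)" using \<epsilon> by simp
    ultimately show ?thesis unfolding b_def by linarith
  next
    case False
    then have "\<epsilon> * 1 \<le> \<epsilon> * exp (\<theta> * x)" using \<theta> \<epsilon> by (intro mult_left_mono) auto
    moreover have "0 < exp (- \<theta> * x)" by simp
    ultimately show ?thesis unfolding b_def by linarith
  qed
qed

text \<open>
  A bootstrap in the constant. The set of admissible constants \<open>Z\<close> in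
  \<open>\<bar>u\<bar>, \<bar>\<partial>\<^sub>x u\<bar> \<le> Z * exp (L * t) * b\<close> contains a large number, and with \<open>Z\<close> it contains
  \<open>max A (Z / 2)\<close>; hence it contains \<open>A\<close>.
\<close>
lemma classical_solution_decay:
  fixes u ux :: "real \<Rightarrow> real \<Rightarrow> real" and T K \<theta> A :: real
  defines "p \<equiv> \<lambda>t. Defs.convolution (deriv G) (\<lambda>y. (u t y)\<^sup>2 + (ux t y)\<^sup>2 / 2)"
  assumes \<theta>: "0 < \<theta>" "\<theta> < 1" and A: "0 < A"
    and cont: "continuous_on ({0..T} \<times> UNIV) (\<lambda>(t, x). u t x)"
    and contx: "\<And>t. t \<in> {0..T} \<Longrightarrow> continuous_on UNIV (ux t)"
    and bdd: "\<And>t x. t \<in> {0..T} \<Longrightarrow> \<bar>u t x\<bar> \<le> K" "\<And>t x. t \<in> {0..T} \<Longrightarrow> \<bar>ux t x\<bar> \<le> K"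
    and dx: "\<And>t x. t \<in> {0..T} \<Longrightarrow> (u t has_real_derivative ux t x) (at x)"
    and dt: "\<And>t x. t \<in> {0..T} \<Longrightarrow> ((\<lambda>t. u t x) has_real_derivative - u t x * ux t x - p t x) (at t within {0..T})"
    and init: "\<And>x. \<bar>u 0 x\<bar> \<le> A * exp (- \<theta> * x)" "\<And>x. \<bar>ux 0 x\<bar> \<le> A * exp (- \<theta> * x)"
  shows "\<exists>C>0. \<forall>t\<in>{0..T}. \<forall>x. \<bar>u t x\<bar> + \<bar>ux t x\<bar> \<le> C * exp (- \<theta> * x)"
proof (cases "0 \<le> T")
  case False then show ?thesis by (auto intro!: exI[of _ 1])
next
  case T: True
  define \<kappa> where "\<kappa> = exp 1 / (1 - \<theta>) + exp (1::real)"
  \<comment> \<open>With this \<open>L\<close> the source, of size \<open>3/2 * K * Z * \<kappa>\<close>, contributes at most \<open>Z / 2\<close> to the maximum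
    principle, whatever \<open>Z\<close> is.\<close>
  define L where "L = K + K * \<theta> + 3 * K * \<kappa> + 1"
  have K0: "0 \<le> K" using bdd(1)[of 0 0] T by auto
  have \<kappa>: "1 / (1 - \<theta>) \<le> \<kappa>" "0 < \<kappa>"
    using \<theta> by (auto simp: \<kappa>_def intro!: add_increasing2 divide_right_mono add_pos_pos)
  have L0: "0 \<le> L" using K0 \<theta> \<kappa> by (simp add: L_def)
  have L1: "L - K - K * \<theta> = 3 * K * \<kappa> + 1" by (simp add: L_def)
  moreover have "0 \<le> 3 * K * \<kappa>" using K0 \<kappa>(2) by simp
  ultimately have L2: "K + K * \<theta> < L" by linarith
  have cont_u: "continuous_on UNIV (u t)" if "t \<in> {0..T}" for t
    by (rule DERIV_continuous_on) (use dx[OF that] in auto)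
  have main: "\<bar>u t x\<bar> \<le> exp (L * t) * (exp (- \<theta> * x) + \<epsilon> * exp (\<theta> * x)) * A
      \<and> \<bar>ux t x\<bar> \<le> exp (L * t) * (exp (- \<theta> * x) + \<epsilon> * exp (\<theta> * x)) * A"
    if \<epsilon>: "0 < \<epsilon>" and t: "t \<in> {0..T}" for \<epsilon> t x
  proof -
    define b where "b x = exp (- \<theta> * x) + \<epsilon> * exp (\<theta> * x)" for x
    define b' where "b' x = \<epsilon> * \<theta> * exp (\<theta> * x) - \<theta> * exp (- \<theta> * x)" for x
    note bw = exp_two_sided_weight[OF \<theta>(1) \<epsilon>, folded b_def b'_def]
    define good where "good Z \<longleftrightarrow> (\<forall>t\<in>{0..T}. \<forall>x. \<bar>u t x\<bar> \<le> exp (L * t) * b x * Z \<and> \<bar>ux t x\<bar> \<le> exp (L * t) * b x * Z)" for Z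
    have exp_b: "exp (- \<theta> * x) \<le> b x" for x using \<epsilon> by (simp add: b_def)
    have step: "good (max A (Z / 2))" if Z: "good Z" "0 \<le> Z" for Z
    proof -
      define S where "S t = 3 / 2 * K * Z * exp (L * t)" for t
      have S0: "0 \<le> S t" for t using K0 Z by (simp add: S_def)
      define F where "F t y = (u t y)\<^sup>2 + (ux t y)\<^sup>2 / 2" for t y
      have Fm: "F t \<in> borel_measurable borel" if "t \<in> {0..T}" for t
        unfolding F_def by (intro borel_measurable_continuous_onI continuous_intros cont_u contx that) simp
      have FS: "\<bar>F t y\<bar> \<le> S t * b y" if t: "t \<in> {0..T}" for t y
      proof -
        have "(u t y)\<^sup>2 \<le> K * (exp (L * t) * b y * Z)" "(ux t y)\<^sup>2 \<le> K * (exp (L * t) * b y * Z)"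
          using Z(1) bdd[OF t, of y] t K0 unfolding good_def power2_eq_square
          by (metis abs_ge_zero abs_mult_self_eq mult_mono)+
        then have "(u t y)\<^sup>2 + (ux t y)\<^sup>2 / 2 \<le> 3 / 2 * (K * (exp (L * t) * b y * Z))" by simp
        then show ?thesis by (simp add: F_def S_def mult_ac)
      qed
      have p_le: "\<bar>p t x\<bar> \<le> S t * b x / (1 - \<theta>)" if t: "t \<in> {0..T}" for t x
        unfolding p_def F_def[symmetric]
        by (rule convolution_deriv_G_bound[OF Fm[OF t] FS[OF t] S0 less_imp_le[OF \<theta>(1)] \<theta>(2) bw(6) bw(1)])
      have p_diff: "\<bar>p t (x + h) - p t x\<bar> \<le> h * (S t * b x * \<kappa>)" if t: "t \<in> {0..T}" and h: "0 < h" "h \<le> 1" for t x h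
        unfolding p_def F_def[symmetric] \<kappa>_def
        by (rule convolution_deriv_G_diff[OF Fm[OF t] FS[OF t] S0 less_imp_le[OF \<theta>(1)] \<theta>(2) bw(6) bw(1) h])
      have S\<kappa>: "S t * b x * \<kappa> = 3 / 2 * K * Z * \<kappa> * exp (L * t) * b x" for t x by (simp add: S_def)
      have max_le: "max A (3 / 2 * K * Z * \<kappa> / (L - K - K * \<theta>)) \<le> max A (Z / 2)"
      proof -
        have "3 / 2 * K * Z * \<kappa> / (L - K - K * \<theta>) \<le> Z / 2"
          using L1 L2 Z(2) by (simp add: pos_divide_le_eq algebra_simps)
        then show ?thesis by (simp add: max.coboundedI2)
      qed
      have weaken: "exp (L * t) * b x * max A (3 / 2 * K * Z * \<kappa> / (L - K - K * \<theta>)) \<le> exp (L * t) * b x * max A (Z / 2)" for t x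
        using bw(1)[of x] by (intro mult_left_mono max_le) auto
      have u_le: "\<bar>u t x\<bar> \<le> exp (L * t) * b x * max A (Z / 2)" if t: "t \<in> {0..T}" for t x
      proof (rule order_trans[OF _ weaken], rule transport_maximum_principle[OF cont bdd(1) dt dx bw(1-5) bdd(1) _ _ _ L0 L2 t])
        fix t x assume t: "t \<in> {0..T}"
        have "\<bar>- u t x * ux t x - p t x + u t x * ux t x\<bar> = \<bar>p t x\<bar>" by simp
        also have "\<dots> \<le> S t * b x * (1 / (1 - \<theta>))" using p_le[OF t, of x] by simp
        also have "\<dots> \<le> S t * b x * \<kappa>" using S0[of t] bw(1)[of x] \<kappa> by (intro mult_left_mono) auto
        also have "\<dots> \<le> 3 / 2 * K * Z * \<kappa> * exp (L * t) * b x + K * \<bar>u t x\<bar>"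
          unfolding S\<kappa> using K0 by simp
        finally show "\<bar>- u t x * ux t x - p t x + u t x * ux t x\<bar> \<le> 3 / 2 * K * Z * \<kappa> * exp (L * t) * b x + K * \<bar>u t x\<bar>" .
      next
        show "\<bar>u 0 x\<bar> \<le> A * b x" for x
          using order_trans[OF init(1)[of x] mult_left_mono[OF exp_b, of A x]] A by simp
      qed (use A in auto)
      have quot_le: "\<bar>(u t (x + h) - u t x) / h\<bar> \<le> exp (L * t) * b x * max A (Z / 2)"
        if h: "0 < h" "h \<le> 1" and t: "t \<in> {0..T}" for t x h
      proof -
        define w where "w t x = (u t (x + h) - u t x) / h" for t x
        define wx where "wx t x = (ux t (x + h) - ux t x) / h" for t x
        define wt where "wt t x = ((- u t (x + h) * ux t (x + h) - p t (x + h)) - (- u t x * ux t x - p t x)) / h" for t x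
        have "\<bar>w t x\<bar> \<le> exp (L * t) * b x * max A (3 / 2 * K * Z * \<kappa> / (L - K - K * \<theta>))"
        proof (rule transport_maximum_principle[where w=w and wt=wt and wx=wx and M=K, OF _ _ _ _ bw(1-5) bdd(1) _ _ _ L0 L2 t])
          have "continuous_on ({0..T} \<times> UNIV) (\<lambda>(t, x). u t (x + h))"
            using continuous_on_compose2[OF cont, of "{0..T} \<times> UNIV" "\<lambda>(t, x). (t, x + h)"]
            by (force simp: split_beta intro!: continuous_intros)
          with cont show "continuous_on ({0..T} \<times> UNIV) (\<lambda>(t, x). w t x)"
            using h unfolding w_def split_beta by (intro continuous_intros) auto
          show "\<bar>w t x\<bar> \<le> K" if "t \<in> {0..T}" for t x
          proof -
            have "norm (u t (x + h) - u t x) \<le> K * norm ((x + h) - x)"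
              by (rule field_differentiable_bound[of UNIV "u t" "ux t"]) (simp_all add: dx[OF that] bdd(2)[OF that])
            then show ?thesis using h by (simp add: w_def field_simps)
          qed
          show "((\<lambda>t. w t x) has_real_derivative wt t x) (at t within {0..T})" if "t \<in> {0..T}" for t x
            unfolding w_def wt_def by (intro DERIV_cdivide DERIV_diff dt that)
          show "(w t has_real_derivative wx t x) (at x)" if "t \<in> {0..T}" for t x
            unfolding w_def wx_def
            by (intro DERIV_cdivide DERIV_diff dx that DERIV_shift[THEN iffD1])
          show "\<bar>wt t x + u t x * wx t x\<bar> \<le> 3 / 2 * K * Z * \<kappa> * exp (L * t) * b x + K * \<bar>w t x\<bar>" if t: "t \<in> {0..T}" for t x
          proof -
            have "wt t x + u t x * wx t x = - ux t (x + h) * w t x - (p t (x + h) - p t x) / h"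
              using h by (simp add: wt_def wx_def w_def field_simps)
            moreover have "\<bar>- ux t (x + h) * w t x\<bar> \<le> K * \<bar>w t x\<bar>"
              unfolding abs_mult using bdd(2)[OF t] by (intro mult_right_mono) auto
            moreover have "\<bar>(p t (x + h) - p t x) / h\<bar> \<le> S t * b x * \<kappa>"
              using p_diff[OF t h, of x] h by (simp add: field_simps)
            ultimately show ?thesis unfolding S\<kappa>[symmetric] by linarith
          qed
          show "\<bar>w 0 x\<bar> \<le> A * b x" for x
          proof -
            have "norm (u 0 (x + h) - u 0 x) \<le> (A * exp (- \<theta> * x)) * norm ((x + h) - x)"
            proof (rule field_differentiable_bound[of "{x..}" "u 0" "ux 0"])
              show "(u 0 has_field_derivative ux 0 z) (at z within {x..})" for z
                by (rule has_field_derivative_at_within[OF dx]) (use T in auto)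
              show "norm (ux 0 z) \<le> A * exp (- \<theta> * x)" if "z \<in> {x..}" for z
              proof -
                have "\<bar>ux 0 z\<bar> \<le> A * exp (- \<theta> * z)" by (rule init(2))
                also have "\<dots> \<le> A * exp (- \<theta> * x)" using that A \<theta> by (intro mult_left_mono) auto
                finally show ?thesis by simp
              qed
            qed (use h in auto)
            then have "\<bar>w 0 x\<bar> \<le> A * exp (- \<theta> * x)" using h by (simp add: w_def field_simps)
            also have "\<dots> \<le> A * b x" using A exp_b by (intro mult_left_mono) auto
            finally show ?thesis .
          qed
        qed (use A in auto)
        also note weaken
        finally show ?thesis by (simp add: w_def)
      qed
      have "\<bar>ux t x\<bar> \<le> exp (L * t) * b x * max A (Z / 2)" if t: "t \<in> {0..T}" for t x
      proof (rule tendsto_upperbound)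
        have "((\<lambda>h. (u t (x + h) - u t x) / h) \<longlongrightarrow> ux t x) (at_right 0)"
          using dx[OF t, of x] unfolding DERIV_def by (rule tendsto_within_subset) auto
        then show "((\<lambda>h. \<bar>(u t (x + h) - u t x) / h\<bar>) \<longlongrightarrow> \<bar>ux t x\<bar>) (at_right 0)" by (rule tendsto_rabs)
        show "\<forall>\<^sub>F h in at_right 0. \<bar>(u t (x + h) - u t x) / h\<bar> \<le> exp (L * t) * b x * max A (Z / 2)"
          unfolding eventually_at_right_field using quot_le[OF _ _ t] by (intro exI[of _ 1]) simp
      qed auto
      with u_le show ?thesis by (auto simp: good_def)
    qed
    \<comment> \<open>The starting constant depends on \<open>\<epsilon>\<close>, but it disappears in the iteration.\<close>
    define Z0 where "Z0 = K / min 1 \<epsilon>"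
    have Z00: "0 \<le> Z0" using K0 \<epsilon> by (simp add: Z0_def)
    have iter: "good (max A (Z0 / 2 ^ n))" for n
    proof (induction n)
      case 0
      have "K \<le> exp (L * t) * b x * max A Z0" if "t \<in> {0..T}" for t x
      proof -
        have "K = 1 * min 1 \<epsilon> * Z0" using \<epsilon> by (simp add: Z0_def)
        also have "\<dots> \<le> exp (L * t) * b x * max A Z0"
          using bw(7)[of x] bw(1)[of x] Z00 L0 that \<epsilon> by (intro mult_mono) auto
        finally show ?thesis .
      qed
      then have "good (max A Z0)" unfolding good_def using bdd by (meson order_trans)
      then show ?case by simp
    next
      case (Suc n)
      have "good (max A (max A (Z0 / 2 ^ n) / 2))" by (rule step[OF Suc.IH]) (use A in simp)
      moreover have "max A (max A (Z0 / 2 ^ n) / 2) = max A (Z0 / 2 ^ Suc n)" using A by (auto simp: max_def)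
      ultimately show ?case by simp
    qed
    obtain n where n: "Z0 / A < 2 ^ n" using real_arch_pow[of 2 "Z0 / A"] by auto
    then have "Z0 / 2 ^ n \<le> A" using A by (simp add: field_simps)
    then have "good A" using iter[of n] by (simp add: max_absorb1)
    then show ?thesis using t unfolding good_def b_def by blast
  qed
  have lim: "\<bar>v\<bar> \<le> exp (L * t) * exp (- \<theta> * x) * A"
    if v: "\<And>\<epsilon>. 0 < \<epsilon> \<Longrightarrow> \<bar>v\<bar> \<le> exp (L * t) * (exp (- \<theta> * x) + \<epsilon> * exp (\<theta> * x)) * A" for v t x
  proof (rule tendsto_lowerbound)
    show "((\<lambda>\<epsilon>. exp (L * t) * (exp (- \<theta> * x) + \<epsilon> * exp (\<theta> * x)) * A) \<longlongrightarrow> exp (L * t) * exp (- \<theta> * x) * A) (at_right 0)"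
      by (auto intro!: tendsto_eq_intros)
    show "\<forall>\<^sub>F \<epsilon> in at_right 0. \<bar>v\<bar> \<le> exp (L * t) * (exp (- \<theta> * x) + \<epsilon> * exp (\<theta> * x)) * A"
      unfolding eventually_at_right_field using v by (intro exI[of _ 1]) auto
  qed auto
  show ?thesis
  proof (intro exI[of _ "2 * A * exp (L * T)"] conjI ballI allI)
    show "0 < 2 * A * exp (L * T)" using A by simp
    fix t x assume t: "t \<in> {0..T}"
    have "\<bar>u t x\<bar> + \<bar>ux t x\<bar> \<le> 2 * (exp (L * t) * exp (- \<theta> * x) * A)"
      using lim[of "u t x" t x] lim[of "ux t x" t x] main[OF _ t] by fastforce
    also have "\<dots> \<le> 2 * (exp (L * T) * exp (- \<theta> * x) * A)"
      using t L0 A by (intro mult_left_mono mult_right_mono) (auto intro: mult_left_mono)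
    finally show "\<bar>u t x\<bar> + \<bar>ux t x\<bar> \<le> 2 * A * exp (L * T) * exp (- \<theta> * x)" by (simp add: mult_ac)
  qed
qed

section \<open>Strong solutions are classical\<close>

text \<open>
  Boundedness is local in time by the uniform continuity estimate, and passes from short to long
  intervals by bisection.
\<close>
lemma sup_continuous_bounded:
  fixes f N :: "real \<Rightarrow> real \<Rightarrow> real"
  assumes T: "0 \<le> T"
    and N: "\<And>r t x. r \<in> {0..T} \<Longrightarrow> t \<in> {0..T} \<Longrightarrow> \<bar>f r x - f t x\<bar> \<le> N r t"
    and lim: "\<And>t. t \<in> {0..T} \<Longrightarrow> ((\<lambda>r. N r t) \<longlongrightarrow> 0) (at t within {0..T})"
    and bdd: "\<And>t. t \<in> {0..T} \<Longrightarrow> \<exists>B. \<forall>x. \<bar>f t x\<bar> \<le> B"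
  shows "\<exists>K. \<forall>t\<in>{0..T}. \<forall>x. \<bar>f t x\<bar> \<le> K"
proof -
  define P where "P a b \<longleftrightarrow> (\<exists>K. \<forall>t\<in>{a..b} \<inter> {0..T}. \<forall>x. \<bar>f t x\<bar> \<le> K)" for a b
  have "P 0 T"
  proof (rule Bolzano[OF T])
    fix a b c assume "P a b" "P b c"
    then obtain K1 K2 where "\<forall>t\<in>{a..b} \<inter> {0..T}. \<forall>x. \<bar>f t x\<bar> \<le> K1" "\<forall>t\<in>{b..c} \<inter> {0..T}. \<forall>x. \<bar>f t x\<bar> \<le> K2"
      unfolding P_def by blast
    then have "\<forall>t\<in>{a..c} \<inter> {0..T}. \<forall>x. \<bar>f t x\<bar> \<le> max K1 K2"
      by (metis (no_types, opaque_lifting) IntE IntI atLeastAtMost_iff le_max_iff_disj linear)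
    then show "P a c" unfolding P_def by blast
  next
    fix t assume "0 \<le> t" "t \<le> T"
    then have t: "t \<in> {0..T}" by simp
    obtain B where B: "\<And>x. \<bar>f t x\<bar> \<le> B" using bdd[OF t] by blast
    have "\<forall>\<^sub>F r in at t within {0..T}. N r t < 1" using lim[OF t] by (rule order_tendstoD) simp
    then obtain d where d: "d > 0" "\<And>r. r \<in> {0..T} \<Longrightarrow> r \<noteq> t \<Longrightarrow> dist r t < d \<Longrightarrow> N r t < 1"
      unfolding eventually_at by blast
    have "P a b" if ab: "a \<le> t" "t \<le> b" "b - a < d" for a b
      unfolding P_def
    proof (intro exI[of _ "B + 1"] ballI allI)
      fix r x assume r: "r \<in> {a..b} \<inter> {0..T}"
      show "\<bar>f r x\<bar> \<le> B + 1"
      proof (cases "r = t")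
        case True then show ?thesis using B[of x] by simp
      next
        case False
        have "dist r t < d" using r ab by (auto simp: dist_real_def)
        then show ?thesis using d(2)[of r] N[of r t x] B[of x] r t False by auto
      qed
    qed
    then show "\<exists>d>0. \<forall>a b. a \<le> t \<and> t \<le> b \<and> b - a < d \<longrightarrow> P a b" using d(1) by blast
  qed
  then show ?thesis by (simp add: P_def)
qed

lemma sup_continuous_jointly_continuous:
  fixes f N :: "real \<Rightarrow> real \<Rightarrow> real"
  assumes N: "\<And>r t x. r \<in> {0..T} \<Longrightarrow> t \<in> {0..T} \<Longrightarrow> \<bar>f r x - f t x\<bar> \<le> N r t"
    and lim: "\<And>t. t \<in> {0..T} \<Longrightarrow> ((\<lambda>r. N r t) \<longlongrightarrow> 0) (at t within {0..T})"
    and cont: "\<And>t. t \<in> {0..T} \<Longrightarrow> continuous_on UNIV (f t)"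
  shows "continuous_on ({0..T} \<times> UNIV) (\<lambda>(t, x). f t x)"
  unfolding continuous_on_iff
proof (intro ballI allI impI)
  fix p :: "real \<times> real" and e :: real assume p: "p \<in> {0..T} \<times> UNIV" and e: "0 < e"
  obtain t x where tx: "p = (t, x)" by (cases p)
  have t: "t \<in> {0..T}" using p tx by auto
  have "\<forall>\<^sub>F r in at t within {0..T}. N r t < e / 2" using lim[OF t] by (rule order_tendstoD) (use e in simp)
  then obtain d1 where d1: "d1 > 0" "\<And>r. r \<in> {0..T} \<Longrightarrow> r \<noteq> t \<Longrightarrow> dist r t < d1 \<Longrightarrow> N r t < e / 2"
    unfolding eventually_at by blast
  obtain d2 where d2: "d2 > 0" "\<And>y. dist y x < d2 \<Longrightarrow> dist (f t y) (f t x) < e / 2"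
    using cont[OF t] e unfolding continuous_on_iff by (metis UNIV_I half_gt_zero)
  have "dist (f r y) (f t x) < e" if r: "r \<in> {0..T}" and ry: "dist (r, y) (t, x) < min d1 d2" for r y
  proof -
    have 1: "dist r t < d1" "dist y x < d2"
      using ry dist_fst_le[of "(r, y)" "(t, x)"] dist_snd_le[of "(r, y)" "(t, x)"] by auto
    have "\<bar>f r y - f t y\<bar> < e / 2"
      using N[OF r t, of y] d1(2)[OF r _ 1(1)] e by (cases "r = t") force+
    with d2(2)[OF 1(2)] show ?thesis unfolding dist_real_def by linarith
  qed
  then show "\<exists>d>0. \<forall>q\<in>{0..T} \<times> UNIV. dist q p < d \<longrightarrow> dist (case q of (t, x) \<Rightarrow> f t x) (case p of (t, x) \<Rightarrow> f t x) < e"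
    using d1(1) d2(1) tx by (intro exI[of _ "min d1 d2"]) auto
qed

text \<open>
  Applied with exponent \<open>s\<close>, the embedding turns continuity in \<open>H\<^sup>s\<close> into continuity of \<open>u\<close> and
  \<open>\<partial>\<^sub>x u\<close> in time, uniformly in space. The right-hand side of the equation is continuous in
  \<open>x\<close>; exchanging \<open>v t\<close> for it makes the time difference quotients minus their limit continuous
  functions that tend to zero in \<open>H\<^sup>s\<^sup>-\<^sup>1\<close>, hence uniformly.
\<close>
lemma strong_CH_solution_classical:
  assumes T: "0 \<le> T" and s: "s > 3 / 2" and sol: "strong_CH_solution s T u"
  defines "p \<equiv> \<lambda>t. Defs.convolution (deriv G) (\<lambda>y. (u t y)\<^sup>2 + (deriv (u t) y)\<^sup>2 / 2)"
  obtains K where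
    "continuous_on ({0..T} \<times> UNIV) (\<lambda>(t, x). u t x)"
    "\<And>t. t \<in> {0..T} \<Longrightarrow> continuous_on UNIV (deriv (u t))"
    "\<And>t x. t \<in> {0..T} \<Longrightarrow> \<bar>u t x\<bar> \<le> K" "\<And>t x. t \<in> {0..T} \<Longrightarrow> \<bar>deriv (u t) x\<bar> \<le> K"
    "\<And>t x. t \<in> {0..T} \<Longrightarrow> (u t has_real_derivative deriv (u t) x) (at x)"
    "\<And>t x. t \<in> {0..T} \<Longrightarrow> ((\<lambda>t. u t x) has_real_derivative - u t x * deriv (u t) x - p t x) (at t within {0..T})"
proof -
  obtain v where v: "sobolev_continuous (s - 1) T v" "sobolev_time_derivative (s - 1) T u v"
    and eq: "\<And>t. t \<in> {0..T} \<Longrightarrow> AE x in lborel. v t x + u t x * deriv (u t) x + p t x = 0"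
    using sol unfolding strong_CH_solution_def p_def by blast
  have us: "u t \<in> sobolev s" and cu: "continuous_on UNIV (u t)" and vs: "v t \<in> sobolev (s - 1)" if "t \<in> {0..T}" for t
    using sol v that by (auto simp: strong_CH_solution_def sobolev_continuous_def)
  have s1: "s > 1 / 2" and s2: "s - 1 > 1 / 2" using s by auto
  obtain C0 where C0: "C0 \<ge> 0" "\<And>f x. f \<in> sobolev s \<Longrightarrow> continuous_on UNIV f \<Longrightarrow> \<bar>f x\<bar> \<le> C0 * sobolev_norm s f"
    by (rule sobolev_sup_bound[OF s1]) blast
  obtain C2 where C2: "C2 \<ge> 0" "\<And>f x. f \<in> sobolev (s - 1) \<Longrightarrow> continuous_on UNIV f \<Longrightarrow> \<bar>f x\<bar> \<le> C2 * sobolev_norm (s - 1) f"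
    by (rule sobolev_sup_bound[OF s2]) blast
  obtain C1 where C1: "C1 \<ge> 0"
    "\<And>f x. f \<in> sobolev s \<Longrightarrow> continuous_on UNIV f \<Longrightarrow> (f has_real_derivative deriv f x) (at x)"
    "\<And>f. f \<in> sobolev s \<Longrightarrow> continuous_on UNIV f \<Longrightarrow> continuous_on UNIV (deriv f)"
    "\<And>f x. f \<in> sobolev s \<Longrightarrow> continuous_on UNIV f \<Longrightarrow> \<bar>deriv f x\<bar> \<le> C1 * sobolev_norm s f"
    by (rule sobolev_deriv_bound[OF s]) blast
  have dx: "(u t has_real_derivative deriv (u t) x) (at x)" if "t \<in> {0..T}" for t x
    by (rule C1(2)[OF us[OF that] cu[OF that]])
  have cd: "continuous_on UNIV (deriv (u t))" if "t \<in> {0..T}" for t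
    by (rule C1(3)[OF us[OF that] cu[OF that]])
  define N where "N r t = sobolev_norm s (\<lambda>x. u r x - u t x)" for r t
  have Nlim: "((\<lambda>r. N r t) \<longlongrightarrow> 0) (at t within {0..T})" if "t \<in> {0..T}" for t
    using sol that by (auto simp: strong_CH_solution_def sobolev_continuous_def N_def)
  have diff_s: "(\<lambda>x. u r x - u t x) \<in> sobolev s" if "r \<in> {0..T}" "t \<in> {0..T}" for r t
    using sobolev_lincomb[OF us[OF that(1)] us[OF that(2)], of 1 "-1"] by simp
  have diff_c: "continuous_on UNIV (\<lambda>x. u r x - u t x)" if "r \<in> {0..T}" "t \<in> {0..T}" for r t
    by (intro continuous_intros cu that)
  have N0: "\<bar>u r x - u t x\<bar> \<le> C0 * N r t" if "r \<in> {0..T}" "t \<in> {0..T}" for r t x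
    unfolding N_def by (rule C0(2)[OF diff_s[OF that] diff_c[OF that]])
  have N1: "\<bar>deriv (u r) x - deriv (u t) x\<bar> \<le> C1 * N r t" if "r \<in> {0..T}" "t \<in> {0..T}" for r t x
    using C1(4)[OF diff_s[OF that] diff_c[OF that], of x]
    unfolding N_def DERIV_imp_deriv[OF DERIV_diff[OF dx[OF that(1)] dx[OF that(2)]]] .
  have lim0: "((\<lambda>r. C0 * N r t) \<longlongrightarrow> 0) (at t within {0..T})"
    and lim1: "((\<lambda>r. C1 * N r t) \<longlongrightarrow> 0) (at t within {0..T})" if "t \<in> {0..T}" for t
    by (intro tendsto_mult_right_zero Nlim that)+
  obtain K0 where K0: "\<And>t x. t \<in> {0..T} \<Longrightarrow> \<bar>u t x\<bar> \<le> K0"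
    using sup_continuous_bounded[where f=u, OF T N0 lim0] C0(2)[OF us cu] by metis
  obtain K1 where K1: "\<And>t x. t \<in> {0..T} \<Longrightarrow> \<bar>deriv (u t) x\<bar> \<le> K1"
    using sup_continuous_bounded[where f="\<lambda>t. deriv (u t)", OF T N1 lim1] C1(4)[OF us cu] by metis
  have cont: "continuous_on ({0..T} \<times> UNIV) (\<lambda>(t, x). u t x)"
    by (rule sup_continuous_jointly_continuous[OF N0 lim0 cu])
  have dt: "((\<lambda>t. u t x) has_real_derivative - u t x * deriv (u t) x - p t x) (at t within {0..T})"
    if t: "t \<in> {0..T}" for t x
  proof -
    define W where "W x = - u t x * deriv (u t) x - p t x" for x
    have cp: "continuous_on UNIV (p t)" unfolding p_def
    proof (rule continuous_convolution_deriv_G)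
      show "(\<lambda>y. (u t y)\<^sup>2 + (deriv (u t) y)\<^sup>2 / 2) \<in> borel_measurable borel"
        by (intro borel_measurable_continuous_onI continuous_intros cu cd t) simp
      fix y
      have "(u t y)\<^sup>2 \<le> K0\<^sup>2" "(deriv (u t) y)\<^sup>2 \<le> K1\<^sup>2"
        using K0[OF t, of y] K1[OF t, of y] by (auto simp: abs_le_square_iff[symmetric])
      then show "\<bar>(u t y)\<^sup>2 + (deriv (u t) y)\<^sup>2 / 2\<bar> \<le> K0\<^sup>2 + K1\<^sup>2 / 2" by simp
    qed
    have cW: "continuous_on UNIV W"
      unfolding W_def by (intro continuous_intros cu cd cp t)
    have vW: "AE x in lborel. v t x = W x"
      using eq[OF t] by eventually_elim (simp add: W_def)
    define q where "q r = sobolev_norm (s - 1) (\<lambda>x. (u r x - u t x) / (r - t) - v t x)" for r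
    have bound: "\<bar>(u r x - u t x) / (r - t) - W x\<bar> \<le> C2 * q r" if r: "r \<in> {0..T}" "r \<noteq> t" for r
    proof -
      have "(\<lambda>x. u r x - u t x) \<in> sobolev (s - 1)"
        using diff_s[OF r(1) t] sobolev_antimono[of "s - 1" s] by auto
      from sobolev_lincomb[OF this vs[OF t], of "1 / (r - t)" "-1"]
      have f: "(\<lambda>x. (u r x - u t x) / (r - t) - v t x) \<in> sobolev (s - 1)" by simp
      have c: "continuous_on UNIV (\<lambda>x. (u r x - u t x) / (r - t) - W x)"
        by (intro continuous_intros cu cW t r) (use r in auto)
      then have m: "(\<lambda>x. (u r x - u t x) / (r - t) - W x) \<in> borel_measurable lborel"
        by (simp add: borel_measurable_continuous_onI)
      have ae: "AE x in lborel. (u r x - u t x) / (r - t) - v t x = (u r x - u t x) / (r - t) - W x"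
        using vW by eventually_elim simp
      show ?thesis
        using C2(2)[OF sobolev_cong_AE(1)[OF f m ae] c, of x] sobolev_cong_AE(2)[OF f m ae]
        by (simp add: q_def)
    qed
    have "(q \<longlongrightarrow> 0) (at t within {0..T})"
      using v(2) t by (simp add: sobolev_time_derivative_def q_def[abs_def])
    then have lim: "((\<lambda>r. C2 * q r) \<longlongrightarrow> 0) (at t within {0..T})" by (rule tendsto_mult_right_zero)
    have "\<forall>\<^sub>F r in at t within {0..T}. norm ((u r x - u t x) / (r - t) - W x) \<le> C2 * q r"
      using bound by (simp add: eventually_at_filter)
    from Lim_null_comparison[OF this lim]
    have "((\<lambda>r. (u r x - u t x) / (r - t)) \<longlongrightarrow> W x) (at t within {0..T})" by (simp add: LIM_zero_iff)
    then show ?thesis by (simp add: has_field_derivative_iff W_def)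
  qed
  show ?thesis
    by (rule that[of "max K0 K1"]) (use cont cd K0 K1 dx dt in \<open>auto simp: le_max_iff_disj\<close>)
qed

section \<open>Persistence of exponential decay\<close>

text \<open>
  To the left of any given point \<open>exp (- \<theta> * x)\<close> is bounded below, so boundedness of \<open>f\<close> suffices there.
\<close>
lemma bigo_exp_imp_global_bound:
  fixes f :: "real \<Rightarrow> real"
  assumes \<theta>: "0 < \<theta>" and f: "(\<lambda>x. \<bar>f x\<bar>) \<in> O[at_top](\<lambda>x. exp (- \<theta> * x))" and K: "\<And>x. \<bar>f x\<bar> \<le> K"
  shows "\<exists>A>0. \<forall>x. \<bar>f x\<bar> \<le> A * exp (- \<theta> * x)"
proof -
  obtain c where c: "c > 0" "\<forall>\<^sub>F x in at_top. norm \<bar>f x\<bar> \<le> c * norm (exp (- \<theta> * x))"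
    using f by (rule landau_o.bigE)
  then obtain X where X: "\<And>x. X \<le> x \<Longrightarrow> \<bar>f x\<bar> \<le> c * exp (- \<theta> * x)"
    unfolding eventually_at_top_linorder by auto
  have K0: "0 \<le> K" using K[of 0] by linarith
  show ?thesis
  proof (intro exI[of _ "c + K * exp (\<theta> * X)"] conjI allI)
    show "0 < c + K * exp (\<theta> * X)" using c K0 by (simp add: add_pos_nonneg)
    fix x
    show "\<bar>f x\<bar> \<le> (c + K * exp (\<theta> * X)) * exp (- \<theta> * x)"
    proof (cases "X \<le> x")
      case True
      have "0 \<le> K * exp (\<theta> * X) * exp (- \<theta> * x)" using K0 by simp
      with X[OF True] show ?thesis by (simp add: distrib_right)
    next
      case False
      then have "0 \<le> \<theta> * (X - x)" using \<theta> by simp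
      then have "1 \<le> exp (\<theta> * X) * exp (- \<theta> * x)" by (simp add: algebra_simps flip: exp_add)
      from mult_left_mono[OF this K0] K[of x] have "\<bar>f x\<bar> \<le> K * exp (\<theta> * X) * exp (- \<theta> * x)" by simp
      moreover have "0 \<le> c * exp (- \<theta> * x)" using c by simp
      ultimately show ?thesis by (simp add: distrib_right)
    qed
  qed
qed

theorem theorem1p2:
  fixes T s \<theta> :: real and u :: "real \<Rightarrow> real \<Rightarrow> real" and u0 :: "real \<Rightarrow> real"
  assumes "T > 0" and "s > 3 / 2"
    and "strong_CH_solution s T u"
    and "\<And>x. u0 x = u 0 x"
    and "0 < \<theta>" and "\<theta> < 1"
    and "(\<lambda>x. \<bar>u0 x\<bar>) \<in> O[at_top](\<lambda>x. exp (- \<theta> * x))"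
    and "(\<lambda>x. \<bar>deriv u0 x\<bar>) \<in> O[at_top](\<lambda>x. exp (- \<theta> * x))"
  shows "\<exists>C>0. \<exists>X>0. \<forall>x\<ge>X. \<forall>t\<in>{0..T}.
           \<bar>u t x\<bar> + \<bar>deriv (u t) x\<bar> \<le> C * exp (- \<theta> * x)"
proof -
  have T: "0 \<le> T" and u0: "u0 = u 0" using assms(1,4) by auto
  obtain K where K:
    "continuous_on ({0..T} \<times> UNIV) (\<lambda>(t, x). u t x)"
    "\<And>t. t \<in> {0..T} \<Longrightarrow> continuous_on UNIV (deriv (u t))"
    "\<And>t x. t \<in> {0..T} \<Longrightarrow> \<bar>u t x\<bar> \<le> K" "\<And>t x. t \<in> {0..T} \<Longrightarrow> \<bar>deriv (u t) x\<bar> \<le> K"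
    "\<And>t x. t \<in> {0..T} \<Longrightarrow> (u t has_real_derivative deriv (u t) x) (at x)"
    "\<And>t x. t \<in> {0..T} \<Longrightarrow> ((\<lambda>t. u t x) has_real_derivative - u t x * deriv (u t) x
        - Defs.convolution (deriv G) (\<lambda>y. (u t y)\<^sup>2 + (deriv (u t) y)\<^sup>2 / 2) x) (at t within {0..T})"
    by (rule strong_CH_solution_classical[OF T assms(2,3)]) blast
  obtain A1 where A1: "A1 > 0" "\<And>x. \<bar>u 0 x\<bar> \<le> A1 * exp (- \<theta> * x)"
    using bigo_exp_imp_global_bound[OF assms(5,7)[unfolded u0] K(3)] T by auto
  obtain A2 where A2: "A2 > 0" "\<And>x. \<bar>deriv (u 0) x\<bar> \<le> A2 * exp (- \<theta> * x)"
    using bigo_exp_imp_global_bound[OF assms(5,8)[unfolded u0] K(4)] T by auto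
  define A where "A = max A1 A2"
  have A: "0 < A" "\<And>x. \<bar>u 0 x\<bar> \<le> A * exp (- \<theta> * x)" "\<And>x. \<bar>deriv (u 0) x\<bar> \<le> A * exp (- \<theta> * x)"
    using A1(1)
    by (simp_all add: A_def order_trans[OF A1(2)] order_trans[OF A2(2)] mult_right_mono del: mult_minus_left)
  obtain C where "C > 0" "\<forall>t\<in>{0..T}. \<forall>x. \<bar>u t x\<bar> + \<bar>deriv (u t) x\<bar> \<le> C * exp (- \<theta> * x)"
    using classical_solution_decay[OF assms(5,6) A(1) K A(2,3)] by blast
  then show ?thesis by (intro exI[of _ C] conjI exI[of _ 1]) auto
qed

end
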